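(* Let $p\in\{0,1,\ldots,6\}$, let $\Omega\subseteq\mathbb{O}$ be a slice domain and let $f,g:\Omega\to\mathbb{O}$ be (left) generalized partial-slice monogenic functions of type $p$. If there is $\underline{\omega}\in\mathbb{S}$ such that $f=g$ on a $(p+1)$-dimensional smooth manifold contained in $\Omega_{\underline{\omega}}$, then $f\equiv g$ in $\Omega$.
   Context: $\mathbb{O}$ is the real, non-associative, alternative algebra of octonions with basis $e_0=1,e_1,\ldots,e_7$ and product $e_ie_j=-\delta_{ij}+\sum_k\epsilon_{ijk}e_k$ for $1\le i,j\le 7$, where $\epsilon_{ijk}$ is totally antisymmetric, equals $1$ on the triples $(1,2,3),(1,4,5),(2,4,6),(3,4,7),(5,3,6),(6,1,7),(7,2,5)$, and vanishes on triples that are not permutations of these. $\mathbb{O}$ is identified with $\mathbb{R}^8$ with its Euclidean norm $|\cdot|$. A domain is a connected open set. Fix $p\in\{0,\ldots,6\}$ and $q=7-p$. Write $\boldsymbol{x}\in\mathbb{O}$ as $\boldsymbol{x}=\boldsymbol{x}_p+\underline{\boldsymbol{x}}_q$ with $\boldsymbol{x}_p=\sum_{i=0}^p x_ie_i\in\mathbb{R}^{p+1}$ and $\underline{\boldsymbol{x}}_q=\sum_{i=p+1}^7x_ie_i\in\mathbb{R}^q$. Let $\mathbb{S}=\{\sum_{i=p+1}^7x_ie_i:\sum_{i=p+1}^7x_i^2=1\}$. For $\Omega\subseteq\mathbb{O}$ open and $\underline{\omega}\in\mathbb{S}$ put $\Omega_{\underline{\omega}}=\Omega\cap(\mathbb{R}^{p+1}\oplus\underline{\omega}\mathbb{R})$,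 viewed as an open subset of $\mathbb{R}^{p+2}$ with coordinates $(x_0,\ldots,x_p,r)\leftrightarrow\boldsymbol{x}_p+r\underline{\omega}$. A function $f:\Omega\to\mathbb{O}$ on a domain $\Omega\subseteq\mathbb{O}$ is (left) generalized partial-slice monogenic of type $p$ if, for every $\underline{\omega}\in\mathbb{S}$, its restriction $f_{\underline{\omega}}$ to $\Omega_{\underline{\omega}}$ is of class $C^1$ and satisfies $D_{\underline{\omega}}f_{\underline{\omega}}:=\sum_{i=0}^pe_i\,\partial_{x_i}f_{\underline{\omega}}+\underline{\omega}\,\partial_rf_{\underline{\omega}}=0$ on $\Omega_{\underline{\omega}}$. A domain $\Omega$ is a slice domain if $\Omega\cap\mathbb{R}^{p+1}\ne\emptyset$ and $\Omega_{\underline{\omega}}$ is a domain in $\mathbb{R}^{p+2}$ for every $\underline{\omega}\in\mathbb{S}$. *)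

theory Defs
  imports "HOL-Analysis.Analysis"
begin

section \<open>Octonions\<close>

text \<open>The coordinates of an octonion are indexed by the eight-element ring \<open>8\<close> of integers
  modulo 8, so that \<open>x $ of_nat i\<close> is the coordinate \<open>x\<^sub>i\<close> for \<open>i = 0, \<dots>, 7\<close>.\<close>

type_synonym octonion = "real ^ 8"

definition oct_e :: "nat \<Rightarrow> octonion" where
  "oct_e i = axis (of_nat i) 1"

definition oct_triples :: "(nat \<times> nat \<times> nat) set" where
  "oct_triples = {(1,2,3), (1,4,5), (2,4,6), (3,4,7), (5,3,6), (6,1,7), (7,2,5)}"

definition oct_eps :: "nat \<Rightarrow> nat \<Rightarrow> nat \<Rightarrow> real" where
  "oct_eps i j k =
    (if (i,j,k) \<in> oct_triples \<or> (j,k,i) \<in> oct_triples \<or> (k,i,j) \<in> oct_triples then 1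
     else if (j,i,k) \<in> oct_triples \<or> (i,k,j) \<in> oct_triples \<or> (k,j,i) \<in> oct_triples then - 1
     else 0)"

definition oct_e_mult :: "nat \<Rightarrow> nat \<Rightarrow> octonion" where
  "oct_e_mult i j =
    (if i = 0 then oct_e j
     else if j = 0 then oct_e i
     else - (if i = j then 1 else 0) *\<^sub>R oct_e 0 + (\<Sum>k=1..7. oct_eps i j k *\<^sub>R oct_e k))"

text \<open>The bilinear extension of \<open>oct_e_mult\<close>.  The symbol \<open>*\<close> on \<^typ>\<open>real ^ 8\<close> is the
  componentwise product and plays no role here.\<close>

definition oct_mult :: "octonion \<Rightarrow> octonion \<Rightarrow> octonion" (infixl \<open>\<odot>\<close> 70) where
  "x \<odot> y = (\<Sum>i\<le>7. \<Sum>j\<le>7. (x $ of_nat i * y $ of_nat j) *\<^sub>R oct_e_mult i j)"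

lemma of_nat_8_eq_iff:
  assumes "i \<le> 7" "j \<le> 7"
  shows "(of_nat i :: 8) = of_nat j \<longleftrightarrow> i = j"
proof -
  have "i \<in> {0,1,2,3,4,5,6,7}" "j \<in> {0,1,2,3,4,5,6,7}"
    using assms by auto
  then show ?thesis
    by auto
qed

lemma oct_e_mult_eq:
  assumes "i \<le> 7" "j \<le> 7"
  shows "oct_e i \<odot> oct_e j = oct_e_mult i j"
proof -
  have "oct_e i \<odot> oct_e j =
      (\<Sum>k\<le>7. \<Sum>l\<le>7. if l = j then (if k = i then oct_e_mult k l else 0) else 0)"
    unfolding oct_mult_def using assms
    by (intro sum.cong refl) (auto simp: oct_e_def axis_def of_nat_8_eq_iff)
  also have "\<dots> = oct_e_mult i j"
    using assms by (simp add: sum.delta)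
  finally show ?thesis .
qed

section \<open>Slices\<close>

definition paravectors :: "nat \<Rightarrow> octonion set" where
  "paravectors p = {(\<Sum>i=0..p. a i *\<^sub>R oct_e i) | a :: nat \<Rightarrow> real. True}"

definition slice_sphere :: "nat \<Rightarrow> octonion set" where
  "slice_sphere p =
    {(\<Sum>i=p+1..7. a i *\<^sub>R oct_e i) | a :: nat \<Rightarrow> real. (\<Sum>i=p+1..7. (a i)\<^sup>2) = 1}"

definition slice_space :: "nat \<Rightarrow> octonion \<Rightarrow> octonion set" where
  "slice_space p \<omega> = {x + r *\<^sub>R \<omega> | x r. x \<in> paravectors p}"

definition slice :: "nat \<Rightarrow> octonion set \<Rightarrow> octonion \<Rightarrow> octonion set" where
  "slice p \<Omega> \<omega> = \<Omega> \<inter> slice_space p \<omega>"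

definition slice_domain :: "nat \<Rightarrow> octonion set \<Rightarrow> bool" where
  "slice_domain p \<Omega> \<longleftrightarrow>
     open \<Omega> \<and> connected \<Omega> \<and> \<Omega> \<inter> paravectors p \<noteq> {} \<and>
     (\<forall>\<omega>\<in>slice_sphere p.
        openin (top_of_set (slice_space p \<omega>)) (slice p \<Omega> \<omega>) \<and> connected (slice p \<Omega> \<omega>))"

section \<open>Generalized partial-slice monogenic functions\<close>

text \<open>In the coordinates \<open>(x\<^sub>0, \<dots>, x\<^sub>p, r)\<close> of \<open>slice_space p \<omega>\<close>, the partial derivative of the
  restriction of \<open>f\<close> with respect to \<open>x\<^sub>i\<close> or \<open>r\<close> is the derivative along \<open>oct_e i\<close> or
  \<open>\<omega>\<close>.  It only involves values of \<open>f\<close> on the slice.\<close>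

definition partial :: "(octonion \<Rightarrow> octonion) \<Rightarrow> octonion \<Rightarrow> octonion \<Rightarrow> octonion" where
  "partial f v x = vector_derivative (\<lambda>t::real. f (x + t *\<^sub>R v)) (at 0)"

definition C1_on_slice ::
    "nat \<Rightarrow> octonion set \<Rightarrow> octonion \<Rightarrow> (octonion \<Rightarrow> octonion) \<Rightarrow> bool" where
  "C1_on_slice p \<Omega> \<omega> f \<longleftrightarrow>
     (\<forall>v \<in> insert \<omega> (oct_e ` {0..p}).
        (\<forall>x\<in>slice p \<Omega> \<omega>. (\<lambda>t::real. f (x + t *\<^sub>R v)) differentiable at 0) \<and>
        continuous_on (slice p \<Omega> \<omega>) (partial f v))"

definition slice_dirac ::
    "nat \<Rightarrow> octonion \<Rightarrow> (octonion \<Rightarrow> octonion) \<Rightarrow> octonion \<Rightarrow> octonion" where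
  "slice_dirac p \<omega> f x = (\<Sum>i=0..p. oct_e i \<odot> partial f (oct_e i) x) + \<omega> \<odot> partial f \<omega> x"

definition partial_slice_monogenic ::
    "nat \<Rightarrow> octonion set \<Rightarrow> (octonion \<Rightarrow> octonion) \<Rightarrow> bool" where
  "partial_slice_monogenic p \<Omega> f \<longleftrightarrow>
     open \<Omega> \<and> connected \<Omega> \<and>
     (\<forall>\<omega>\<in>slice_sphere p.
        C1_on_slice p \<Omega> \<omega> f \<and> (\<forall>x\<in>slice p \<Omega> \<omega>. slice_dirac p \<omega> f x = 0))"

section \<open>Smooth submanifolds of Euclidean space\<close>

text \<open>Used for open sets only, where \<open>frechet_derivative f (at x)\<close> is the total derivative.\<close>

primrec Ck_on :: "nat \<Rightarrow> ('a::euclidean_space \<Rightarrow> 'b::euclidean_space) \<Rightarrow> 'a set \<Rightarrow> bool" where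
  "Ck_on 0 f U \<longleftrightarrow> continuous_on U f"
| "Ck_on (Suc k) f U \<longleftrightarrow>
     (\<forall>x\<in>U. f differentiable at x) \<and> (\<forall>v. Ck_on k (\<lambda>x. frechet_derivative f (at x) v) U)"

definition smooth_on :: "('a::euclidean_space \<Rightarrow> 'b::euclidean_space) \<Rightarrow> 'a set \<Rightarrow> bool" where
  "smooth_on f U \<longleftrightarrow> (\<forall>k. Ck_on k f U)"

text \<open>Nonempty embedded submanifolds without boundary, described by local flattenings.\<close>

definition smooth_submanifold :: "nat \<Rightarrow> 'a::euclidean_space set \<Rightarrow> bool" where
  "smooth_submanifold d M \<longleftrightarrow> M \<noteq> {} \<and>
     (\<forall>a\<in>M. \<exists>U V (\<phi> :: 'a \<Rightarrow> 'a) \<psi> L.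
        open U \<and> a \<in> U \<and> open V \<and> homeomorphism U V \<phi> \<psi> \<and>
        smooth_on \<phi> U \<and> smooth_on \<psi> V \<and>
        subspace L \<and> dim L = d \<and> \<phi> ` (M \<inter> U) = L \<inter> V)"

end

theory Submission
  imports Defs
begin

text \<open>On one slice the difference \<open>h = f - g\<close> solves the first-order system
  \<open>D h = (\<Sum>b\<in>B. L b (\<partial>\<^sub>b h)) = 0\<close>, where \<open>B\<close> is an orthonormal basis of the slice space and \<open>L b\<close> is
  octonionic left multiplication.  The product enters only through bilinearity and \<open>norm_oct_mult\<close>,
  \<open>norm (a \<odot> x) = norm a * norm x\<close>: this makes \<open>D\<close> an operator of Dirac type, and the analysis is
  done for such operators in the locale \<open>dirac\<close>.

  The core is \<open>unique_continuation\<close>: a solution on a ball that vanishes near the centre vanishes on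
  the whole ball.  It rests on the weighted inequality
  \<open>carleman\<close>, \<open>\<integral> (4 t / \<rho> - n\<^sup>2 / 4) exp (2 t / \<rho>) |u|\<^sup>2 \<le> \<integral> \<rho> exp (2 t / \<rho>) |D u|\<^sup>2\<close>, with \<open>\<rho>\<close> the
  squared distance from the centre, \<open>n = card B\<close> and \<open>t \<rightarrow> \<infinity>\<close>.  Chains of balls turn it into an
  identity theorem on connected slices, \<open>identity_theorem_slice\<close>.

  Suppose that \<open>h\<close> vanishes on a hypersurface of the slice.  Its tangential derivatives vanish there,
  and then the equation \<open>D h = 0\<close> forces the normal derivative to vanish as well
  (\<open>gradient_zero_if_tangential_zero\<close>).  So \<open>h\<close> can be replaced by \<open>0\<close> on one side of the hypersurface
  without losing differentiability or the equation, and unique continuation from that side shows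
  that \<open>h\<close> vanishes on the other side too (\<open>vanishing_across_hypersurface\<close>).  For a submanifold the
  two sides are read off from a chart (\<open>vanishing_near_submanifold\<close>).

  Hence \<open>f = g\<close> on the slice that contains the manifold, in particular on the nonempty intersection of
  \<open>\<Omega>\<close> with the paravectors.  That intersection is a hypersurface in every other slice, so the same
  argument applies there (\<open>vanishing_on_paravectors_spreads\<close>), and the slices cover \<open>\<Omega>\<close>.

  The dimension of the slice space depends on \<open>p\<close>, so a function on it is composed with the orthogonal
  projection and integrated over the whole Euclidean space against a cutoff that is constant along
  the slice space.\<close>

section \<open>Derivatives along vectors and integration by parts\<close>

text \<open>Continuous functions of compact support; in a Euclidean space bounded support is the same and
  is easier to pass to derivatives and translates.\<close>

definition Cc :: "('a::euclidean_space \<Rightarrow> 'b::euclidean_space) \<Rightarrow> bool" where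
  "Cc f \<longleftrightarrow> continuous_on UNIV f \<and> (\<exists>r. \<forall>x. r < norm x \<longrightarrow> f x = 0)"

text \<open>The derivatives are data, and only those along \<open>B\<close> are asked for: the functions of interest live
  on a slice, and across it they are extended by merely continuous cutoffs.\<close>

definition C1_along ::
    "'a::euclidean_space set \<Rightarrow> 'a set \<Rightarrow> ('a \<Rightarrow> 'b::euclidean_space) \<Rightarrow> ('a \<Rightarrow> 'a \<Rightarrow> 'b) \<Rightarrow> bool" where
  "C1_along B S u du \<longleftrightarrow> continuous_on S u \<and>
     (\<forall>b\<in>B. continuous_on S (du b) \<and>
       (\<forall>x\<in>S. ((\<lambda>t. u (x + t *\<^sub>R b)) has_vector_derivative du b x) (at 0)))"

lemma C1_alongI:
  assumes "continuous_on S u" "\<And>b. b \<in> B \<Longrightarrow> continuous_on S (du b)"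
    "\<And>b x. b \<in> B \<Longrightarrow> x \<in> S \<Longrightarrow> ((\<lambda>t. u (x + t *\<^sub>R b)) has_vector_derivative du b x) (at 0)"
  shows "C1_along B S u du"
  using assms by (auto simp: C1_along_def)

lemma C1_alongD:
  assumes "C1_along B S u du"
  shows "continuous_on S u" "b \<in> B \<Longrightarrow> continuous_on S (du b)"
    "b \<in> B \<Longrightarrow> x \<in> S \<Longrightarrow> ((\<lambda>t. u (x + t *\<^sub>R b)) has_vector_derivative du b x) (at 0)"
  using assms by (auto simp: C1_along_def)

lemma C1_along_subset: "C1_along B S u du \<Longrightarrow> T \<subseteq> S \<Longrightarrow> C1_along B T u du"
  by (auto simp: C1_along_def intro: continuous_on_subset)

lemma eventually_line_in_open:
  fixes x b :: "'a::real_normed_vector"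
  assumes "open S" "x \<in> S"
  shows "\<forall>\<^sub>F t in nhds (0::real). x + t *\<^sub>R b \<in> S"
proof -
  have "open ((\<lambda>t::real. x + t *\<^sub>R b) -` S)"
    by (intro open_vimage assms continuous_intros)
  from eventually_nhds_in_open[OF this, of 0] show ?thesis
    using assms(2) by simp
qed

lemma C1_along_cong:
  assumes "C1_along B S u du" "open S" "\<And>x. x \<in> S \<Longrightarrow> u' x = u x"
    "\<And>b x. b \<in> B \<Longrightarrow> x \<in> S \<Longrightarrow> du' b x = du b x"
  shows "C1_along B S u' du'"
proof (rule C1_alongI)
  show "continuous_on S u'"
    using C1_alongD(1)[OF assms(1)] assms(3) by (simp cong: continuous_on_cong)
  show "continuous_on S (du' b)" if "b \<in> B" for b
    using C1_alongD(2)[OF assms(1) that] assms(4)[OF that] by (simp cong: continuous_on_cong)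
  show "((\<lambda>t. u' (x + t *\<^sub>R b)) has_vector_derivative du' b x) (at 0)" if "b \<in> B" "x \<in> S" for b x
  proof -
    have "\<forall>\<^sub>F t in nhds 0. u (x + t *\<^sub>R b) = u' (x + t *\<^sub>R b)"
      using eventually_line_in_open[OF assms(2) that(2), of b] by eventually_elim (simp add: assms(3))
    then have "\<forall>\<^sub>F t in nhds 0. t \<in> UNIV \<longrightarrow> u (x + t *\<^sub>R b) = u' (x + t *\<^sub>R b)"
      by eventually_elim simp
    moreover have "u (x + 0 *\<^sub>R b) = u' (x + 0 *\<^sub>R b)"
      using assms(3) that by simp
    ultimately show ?thesis
      using has_vector_derivative_cong_ev[where x = 0 and S = UNIV and f' = "du b x"
          and f = "\<lambda>t. u (x + t *\<^sub>R b)" and g = "\<lambda>t. u' (x + t *\<^sub>R b)"]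
        C1_alongD(3)[OF assms(1) that] assms(4)[OF that] by simp
  qed
qed

lemma C1_along_Un:
  assumes "C1_along B S u du" "C1_along B T u du" "open S" "open T"
  shows "C1_along B (S \<union> T) u du"
  using assms by (auto simp: C1_along_def intro: continuous_on_open_Un)

lemma C1_along_const: "C1_along B S (\<lambda>x. c) (\<lambda>b x. 0)"
  by (auto simp: C1_along_def)

lemma C1_along_inner: "C1_along B S (\<lambda>x. x \<bullet> a) (\<lambda>b x. b \<bullet> a)"
  unfolding C1_along_def
  by (auto intro!: continuous_intros derivative_eq_intros simp: inner_left_distrib has_real_derivative_iff_has_vector_derivative[symmetric])

lemma C1_along_bilinear:
  fixes \<beta> :: "'b::euclidean_space \<Rightarrow> 'c::euclidean_space \<Rightarrow> 'd::euclidean_space"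
  assumes "bounded_bilinear \<beta>" "C1_along B S u du" "C1_along B S w dw"
  shows "C1_along B S (\<lambda>x. \<beta> (u x) (w x)) (\<lambda>b x. \<beta> (du b x) (w x) + \<beta> (u x) (dw b x))"
proof (rule C1_alongI)
  show "continuous_on S (\<lambda>x. \<beta> (u x) (w x))"
    using assms by (auto intro: bounded_bilinear.continuous_on C1_alongD)
  show "continuous_on S (\<lambda>x. \<beta> (du b x) (w x) + \<beta> (u x) (dw b x))" if "b \<in> B" for b
    using assms that by (auto intro!: continuous_on_add intro: bounded_bilinear.continuous_on C1_alongD)
  show "((\<lambda>t. \<beta> (u (x + t *\<^sub>R b)) (w (x + t *\<^sub>R b))) has_vector_derivative
      \<beta> (du b x) (w x) + \<beta> (u x) (dw b x)) (at 0)" if "b \<in> B" "x \<in> S" for b x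
    using bounded_bilinear.has_vector_derivative[OF assms(1) C1_alongD(3)[OF assms(2) that] C1_alongD(3)[OF assms(3) that]]
    by (simp add: add.commute)
qed

lemma C1_along_scaleR:
  fixes u :: "'a::euclidean_space \<Rightarrow> real"
  assumes "C1_along B S u du" "C1_along B S w dw"
  shows "C1_along B S (\<lambda>x. u x *\<^sub>R w x) (\<lambda>b x. du b x *\<^sub>R w x + u x *\<^sub>R dw b x)"
  using C1_along_bilinear[OF bounded_bilinear_scaleR assms] .

lemma C1_along_sum:
  assumes "\<And>i. i \<in> I \<Longrightarrow> C1_along B S (u i) (du i)"
  shows "C1_along B S (\<lambda>x. \<Sum>i\<in>I. u i x) (\<lambda>b x. \<Sum>i\<in>I. du i b x)"
  using assms by (auto simp: C1_along_def intro!: continuous_on_sum has_vector_derivative_sum)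

lemma C1_along_real_compose:
  fixes u :: "'a::euclidean_space \<Rightarrow> real" and F F' :: "real \<Rightarrow> real"
  assumes "C1_along B S u du"
    "\<And>y. y \<in> T \<Longrightarrow> (F has_real_derivative F' y) (at y)" "continuous_on T F'"
    "\<And>x. x \<in> S \<Longrightarrow> u x \<in> T"
  shows "C1_along B S (\<lambda>x. F (u x)) (\<lambda>b x. F' (u x) * du b x)"
proof (rule C1_alongI)
  have F: "continuous_on T F"
    using assms(2) by (intro DERIV_continuous_on) (blast intro: DERIV_subset)
  show "continuous_on S (\<lambda>x. F (u x))"
    using continuous_on_compose2[OF F C1_alongD(1)[OF assms(1)]] assms(4) by blast
  show "continuous_on S (\<lambda>x. F' (u x) * du b x)" if "b \<in> B" for b
    using continuous_on_compose2[OF assms(3) C1_alongD(1)[OF assms(1)]] assms(4)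
    by (auto intro!: continuous_on_mult C1_alongD(2)[OF assms(1) that])
  show "((\<lambda>t. F (u (x + t *\<^sub>R b))) has_vector_derivative F' (u x) * du b x) (at 0)"
    if "b \<in> B" "x \<in> S" for b x
    using DERIV_chain2[of F "F' (u x)" "\<lambda>t. u (x + t *\<^sub>R b)" 0 "du b x"] assms(2)[OF assms(4)] that
      C1_alongD(3)[OF assms(1) that]
    by (simp add: has_real_derivative_iff_has_vector_derivative[symmetric])
qed

lemma C1_along_line:
  assumes "C1_along B UNIV u du" "b \<in> B"
  shows "((\<lambda>t. u (x + t *\<^sub>R b)) has_vector_derivative du b (x + s *\<^sub>R b)) (at s)"
proof -
  have "((\<lambda>t. u ((x + s *\<^sub>R b) + t *\<^sub>R b)) has_vector_derivative du b (x + s *\<^sub>R b)) (at (s - s))"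
    using C1_alongD(3)[OF assms] by simp
  from has_vector_derivative_at_within[OF this]
  have *: "((\<lambda>t. u ((x + s *\<^sub>R b) + t *\<^sub>R b)) has_vector_derivative du b (x + s *\<^sub>R b))
      (at (s - s) within range (\<lambda>t. t - s))" .
  have "((\<lambda>t. u (x + s *\<^sub>R b + (t - s) *\<^sub>R b)) has_vector_derivative du b (x + s *\<^sub>R b)) (at s)"
    using vector_diff_chain_within[of "\<lambda>t. t - s" 1 s UNIV, OF has_vector_derivative_diff[OF has_vector_derivative_id has_vector_derivative_const, simplified] *]
    by (simp add: o_def)
  then show ?thesis
    by (simp add: algebra_simps)
qed

lemma CcD: "Cc f \<Longrightarrow> continuous_on UNIV f" "Cc f \<Longrightarrow> \<exists>r>0. \<forall>x. r < norm x \<longrightarrow> f x = 0"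
proof -
  assume "Cc f"
  then obtain r where "\<forall>x. r < norm x \<longrightarrow> f x = 0" by (auto simp: Cc_def)
  then have "\<forall>x. max r 1 < norm x \<longrightarrow> f x = 0" by auto
  then show "\<exists>r>0. \<forall>x. r < norm x \<longrightarrow> f x = 0" by (intro exI[of _ "max r 1"]) auto
qed (auto simp: Cc_def)

lemma Cc_bilinear_left:
  fixes \<beta> :: "'b::euclidean_space \<Rightarrow> 'c::euclidean_space \<Rightarrow> 'd::euclidean_space"
  assumes "bounded_bilinear \<beta>" "Cc f" "continuous_on UNIV g"
  shows "Cc (\<lambda>x. \<beta> (f x) (g x))"
proof -
  obtain r where "\<forall>x. r < norm x \<longrightarrow> f x = 0"
    using assms by (auto simp: Cc_def)
  then have "\<forall>x. r < norm x \<longrightarrow> \<beta> (f x) (g x) = 0"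
    using bounded_bilinear.zero_left[OF assms(1)] by simp
  moreover have "continuous_on UNIV (\<lambda>x. \<beta> (f x) (g x))"
    using assms by (auto simp: Cc_def intro: bounded_bilinear.continuous_on)
  ultimately show ?thesis
    unfolding Cc_def by blast
qed

lemma Cc_bilinear_right:
  fixes \<beta> :: "'b::euclidean_space \<Rightarrow> 'c::euclidean_space \<Rightarrow> 'd::euclidean_space"
  assumes "bounded_bilinear \<beta>" "continuous_on UNIV f" "Cc g"
  shows "Cc (\<lambda>x. \<beta> (f x) (g x))"
proof -
  obtain r where "\<forall>x. r < norm x \<longrightarrow> g x = 0"
    using assms by (auto simp: Cc_def)
  then have "\<forall>x. r < norm x \<longrightarrow> \<beta> (f x) (g x) = 0"
    using bounded_bilinear.zero_right[OF assms(1)] by simp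
  moreover have "continuous_on UNIV (\<lambda>x. \<beta> (f x) (g x))"
    using assms by (auto simp: Cc_def intro: bounded_bilinear.continuous_on)
  ultimately show ?thesis
    unfolding Cc_def by blast
qed

lemma Cc_add: "Cc f \<Longrightarrow> Cc g \<Longrightarrow> Cc (\<lambda>x. f x + g x)"
proof -
  assume f: "Cc f" and g: "Cc g"
  obtain r s where "\<forall>x. r < norm x \<longrightarrow> f x = 0" "\<forall>x. s < norm x \<longrightarrow> g x = 0"
    using f g by (auto simp: Cc_def)
  then have "\<forall>x. max r s < norm x \<longrightarrow> f x + g x = 0" by simp
  then show ?thesis
    using f g unfolding Cc_def by (blast intro: continuous_intros)
qed

lemma Cc_zero: "Cc (\<lambda>x. 0)"
  by (auto simp: Cc_def)

lemma Cc_sum: "(\<And>i. i \<in> I \<Longrightarrow> Cc (f i)) \<Longrightarrow> Cc (\<lambda>x. \<Sum>i\<in>I. f i x)"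
  by (induction I rule: infinite_finite_induct) (auto intro: Cc_add Cc_zero)

lemma Cc_scaleR_right: "continuous_on UNIV f \<Longrightarrow> Cc g \<Longrightarrow> Cc (\<lambda>x. f x *\<^sub>R g x)" for f :: "_ \<Rightarrow> real"
  using Cc_bilinear_right[OF bounded_bilinear_scaleR] by blast

lemma Cc_mult_right: "continuous_on UNIV f \<Longrightarrow> Cc g \<Longrightarrow> Cc (\<lambda>x. f x * g x)" for f g :: "_ \<Rightarrow> real"
  using Cc_bilinear_right[OF bounded_bilinear_mult] by blast

lemma Cc_diff: "Cc f \<Longrightarrow> Cc g \<Longrightarrow> Cc (\<lambda>x. f x - g x)"
  using Cc_add[of f "\<lambda>x. (-1) *\<^sub>R g x"] Cc_scaleR_right[of "\<lambda>_. -1" g] by simp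

lemma Cc_translate: "Cc f \<Longrightarrow> Cc (\<lambda>x. f (x + c))"
proof -
  assume f: "Cc f"
  then obtain r where r: "\<forall>x. r < norm x \<longrightarrow> f x = 0" by (auto simp: Cc_def)
  have "\<forall>x. r + norm c < norm x \<longrightarrow> f (x + c) = 0"
    using r norm_diff_ineq by (smt (verit))
  moreover have "continuous_on UNIV (\<lambda>x. f (x + c))"
    by (rule continuous_on_compose2[OF CcD(1)[OF f]]) (auto intro: continuous_intros)
  ultimately show ?thesis
    unfolding Cc_def by blast
qed

lemma Cc_integrable:
  assumes "Cc f" shows "integrable lborel f"
proof -
  obtain r where r: "\<forall>x. r < norm x \<longrightarrow> f x = 0"
    using assms by (auto simp: Cc_def)
  have "integrable lborel (\<lambda>x. indicator (cball 0 r) x *\<^sub>R f x)"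
    using assms by (intro borel_integrable_compact) (auto simp: Cc_def intro: continuous_on_subset)
  moreover have "(\<lambda>x. indicator (cball 0 r) x *\<^sub>R f x) = f"
    using r by (auto simp: indicator_def fun_eq_iff)
  ultimately show ?thesis by simp
qed

lemma Cc_derivative:
  assumes "C1_along B UNIV u du" "Cc u" "b \<in> B"
  shows "Cc (du b)"
proof -
  obtain r where r: "\<forall>x. r < norm x \<longrightarrow> u x = 0"
    using assms by (auto simp: Cc_def)
  have "du b x = 0" if "r < norm x" for x
  proof -
    have "open {x. r < norm x}"
      by (intro open_Collect_less continuous_intros)
    then have "C1_along B {x. r < norm x} u (\<lambda>b x. 0)"
      using r by (intro C1_along_cong[OF C1_along_const[of _ _ 0]]) auto
    then show ?thesis
      using vector_derivative_unique_at[OF C1_alongD(3)[OF assms(1,3)] C1_alongD(3)[of _ "{x. r < norm x}"]] that assms(3)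
      by blast
  qed
  then show ?thesis
    using C1_alongD(2)[OF assms(1,3)] by (auto simp: Cc_def)
qed

lemma integral_translate:
  fixes f :: "'a::euclidean_space \<Rightarrow> 'b::euclidean_space"
  assumes "continuous_on UNIV f"
  shows "integral\<^sup>L lborel (\<lambda>x. f (x + c)) = integral\<^sup>L lborel f"
proof -
  have "integral\<^sup>L lborel f = integral\<^sup>L (distr lborel borel ((+) c)) f"
    by (simp add: lborel_distr_plus)
  also have "\<dots> = integral\<^sup>L lborel (\<lambda>x. f (c + x))"
    using assms by (subst integral_distr) (auto intro: borel_measurable_continuous_onI)
  finally show ?thesis by (simp add: add.commute)
qed

lemma integral_eq_integral_cbox:
  assumes "Cc f" "\<And>x. x \<notin> cbox a b \<Longrightarrow> f x = 0"
  shows "integral\<^sup>L lborel f = integral (cbox a b) f"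
proof -
  have "f = (\<lambda>x. if x \<in> cbox a b then f x else 0)"
    using assms(2) by auto
  then have "integral UNIV f = integral (cbox a b) f"
    using integral_restrict_UNIV[of "cbox a b" f] by simp
  then show ?thesis
    using integral_lborel[OF Cc_integrable[OF assms(1)]] by simp
qed

text \<open>For \<open>|s| < 1\<close> all translates \<open>u (x + s b)\<close> are supported in one box, on which the Leibniz rule for
  the gauge integral applies.\<close>

lemma integral_translated_derivative:
  fixes \<beta> :: "'b::euclidean_space \<Rightarrow> 'c::euclidean_space \<Rightarrow> 'd::euclidean_space"
  assumes \<beta>: "bounded_bilinear \<beta>" and u: "C1_along B UNIV u du" "Cc u" and b: "b \<in> B"
    and g: "continuous_on UNIV g"
  shows "((\<lambda>s. integral\<^sup>L lborel (\<lambda>x. \<beta> (u (x + s *\<^sub>R b)) (g x))) has_vector_derivative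
           integral\<^sup>L lborel (\<lambda>x. \<beta> (du b x) (g x))) (at 0)"
proof -
  obtain r where r: "r > 0" "\<forall>x. r < norm x \<longrightarrow> u x = 0"
    using CcD(2)[OF u(2)] by blast
  obtain r' where r': "r' > 0" "\<forall>x. r' < norm x \<longrightarrow> du b x = 0"
    using CcD(2)[OF Cc_derivative[OF u b]] by blast
  obtain c where c: "cball (0::'a) (r + r' + norm b) \<subseteq> cbox (- c) c"
    using bounded_subset_cbox_symmetric bounded_cball by metis
  define U where "U = {-1<..<1::real}"
  have zero_in: "0 \<in> U" by (simp add: U_def)
  have Cu: "Cc (\<lambda>x. \<beta> (u (x + s *\<^sub>R b)) (g x))" for s
    by (rule Cc_bilinear_left[OF \<beta> Cc_translate[OF u(2)] g])
  have Cd: "Cc (\<lambda>x. \<beta> (du b x) (g x))"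
    by (rule Cc_bilinear_left[OF \<beta> Cc_derivative[OF u b] g])
  have zero: "u (x + s *\<^sub>R b) = 0" if "x \<notin> cbox (- c) c" "s \<in> U" for x s
  proof -
    have "norm (s *\<^sub>R b) \<le> norm b"
      using that(2) by (auto simp: U_def intro: mult_left_le_one_le)
    moreover have "norm x > r + r' + norm b"
      using that(1) c by (meson mem_cball_0 not_le subset_eq)
    ultimately have "norm (x + s *\<^sub>R b) > r"
      using norm_diff_ineq[of x "s *\<^sub>R b"] r'(1) by linarith
    then show ?thesis using r by blast
  qed
  have *: "integral\<^sup>L lborel (\<lambda>x. \<beta> (u (x + s *\<^sub>R b)) (g x)) =
      integral (cbox (- c) c) (\<lambda>x. \<beta> (u (x + s *\<^sub>R b)) (g x))" if "s \<in> U" for s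
    using zero[OF _ that] bounded_bilinear.zero_left[OF \<beta>]
    by (intro integral_eq_integral_cbox Cu) simp
  have dzero: "du b x = 0" if "x \<notin> cbox (- c) c" for x
  proof -
    have "norm x > r + r' + norm b"
      using that(1) c by (meson mem_cball_0 not_le subset_eq)
    then have "r' < norm x" using r(1) norm_ge_zero[of b] by linarith
    then show ?thesis using r'(2) by blast
  qed
  have **: "integral\<^sup>L lborel (\<lambda>x. \<beta> (du b x) (g x)) = integral (cbox (- c) c) (\<lambda>x. \<beta> (du b x) (g x))"
    using dzero bounded_bilinear.zero_left[OF \<beta>]
    by (intro integral_eq_integral_cbox Cd) simp
  have ct: "continuous_on X (\<lambda>(s, x). \<beta> (du b (x + s *\<^sub>R b)) (g x))" for X
    unfolding split_beta
    by (intro bounded_bilinear.continuous_on[OF \<beta>] continuous_on_compose2[OF C1_alongD(2)[OF u(1) b]]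
        continuous_on_compose2[OF g]) (auto intro!: continuous_intros)
  have "((\<lambda>s. integral (cbox (- c) c) (\<lambda>x. \<beta> (u (x + s *\<^sub>R b)) (g x))) has_vector_derivative
      integral (cbox (- c) c) (\<lambda>x. \<beta> (du b (x + 0 *\<^sub>R b)) (g x))) (at 0 within U)"
  proof (rule leibniz_rule_vector_derivative[where fx = "\<lambda>s x. \<beta> (du b (x + s *\<^sub>R b)) (g x)"])
    show "((\<lambda>s. \<beta> (u (x + s *\<^sub>R b)) (g x)) has_vector_derivative \<beta> (du b (x + s *\<^sub>R b)) (g x)) (at s within U)" for s x
      using bounded_linear.has_vector_derivative[OF bounded_bilinear.bounded_linear_left[OF \<beta>]
          has_vector_derivative_at_within[OF C1_along_line[OF u(1) b]]] .
    show "(\<lambda>x. \<beta> (u (x + s *\<^sub>R b)) (g x)) integrable_on cbox (- c) c" for s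
      by (rule integrable_continuous[OF continuous_on_subset[OF CcD(1)[OF Cu] subset_UNIV]])
    show "continuous_on (U \<times> cbox (- c) c) (\<lambda>(s, x). \<beta> (du b (x + s *\<^sub>R b)) (g x))"
      by (rule ct)
  qed (auto simp: U_def)
  then have "((\<lambda>s. integral (cbox (- c) c) (\<lambda>x. \<beta> (u (x + s *\<^sub>R b)) (g x))) has_vector_derivative
      integral\<^sup>L lborel (\<lambda>x. \<beta> (du b x) (g x))) (at 0)"
    using ** at_within_open[of 0 U] by (simp add: U_def)
  moreover have "\<forall>\<^sub>F s in nhds 0. s \<in> U"
    using eventually_nhds_in_open[of U 0] by (simp add: U_def)
  then have "\<forall>\<^sub>F s in nhds 0. s \<in> UNIV \<longrightarrow> integral (cbox (- c) c) (\<lambda>x. \<beta> (u (x + s *\<^sub>R b)) (g x))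
      = integral\<^sup>L lborel (\<lambda>x. \<beta> (u (x + s *\<^sub>R b)) (g x))"
    by eventually_elim (simp add: *)
  ultimately show ?thesis
    using has_vector_derivative_cong_ev[where x = 0 and S = UNIV
        and f' = "integral\<^sup>L lborel (\<lambda>x. \<beta> (du b x) (g x))"
        and f = "\<lambda>s. integral (cbox (- c) c) (\<lambda>x. \<beta> (u (x + s *\<^sub>R b)) (g x))"
        and g = "\<lambda>s. integral\<^sup>L lborel (\<lambda>x. \<beta> (u (x + s *\<^sub>R b)) (g x))"] *[OF zero_in]
    by simp
qed

lemma integral_derivative_zero:
  assumes u: "C1_along B UNIV u du" "Cc u" and b: "b \<in> B"
  shows "integral\<^sup>L lborel (du b) = 0"
proof -
  have "((\<lambda>s. integral\<^sup>L lborel (\<lambda>x. 1 *\<^sub>R u (x + s *\<^sub>R b))) has_vector_derivative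
           integral\<^sup>L lborel (\<lambda>x. 1 *\<^sub>R du b x)) (at 0)"
    using integral_translated_derivative[OF bounded_bilinear.flip[OF bounded_bilinear_scaleR] u b continuous_on_const] .
  moreover have "integral\<^sup>L lborel (\<lambda>x. u (x + s *\<^sub>R b)) = integral\<^sup>L lborel u" for s
    using integral_translate[OF CcD(1)[OF u(2)]] .
  ultimately have "((\<lambda>s::real. integral\<^sup>L lborel u) has_vector_derivative integral\<^sup>L lborel (du b)) (at 0)"
    by simp
  then show ?thesis
    using vector_derivative_unique_at has_vector_derivative_const by blast
qed

lemma integral_by_parts:
  fixes \<beta> :: "'b::euclidean_space \<Rightarrow> 'c::euclidean_space \<Rightarrow> 'd::euclidean_space"
  assumes \<beta>: "bounded_bilinear \<beta>" and u: "C1_along B UNIV u du" "Cc u"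
    and w: "C1_along B UNIV w dw" and b: "b \<in> B"
  shows "integral\<^sup>L lborel (\<lambda>x. \<beta> (du b x) (w x)) = - integral\<^sup>L lborel (\<lambda>x. \<beta> (u x) (dw b x))"
proof -
  have "integral\<^sup>L lborel (\<lambda>x. \<beta> (du b x) (w x) + \<beta> (u x) (dw b x)) = 0"
    using integral_derivative_zero[OF C1_along_bilinear[OF \<beta> u(1) w] Cc_bilinear_left[OF \<beta> u(2) C1_alongD(1)[OF w]] b] .
  moreover have "integral\<^sup>L lborel (\<lambda>x. \<beta> (du b x) (w x) + \<beta> (u x) (dw b x)) =
     integral\<^sup>L lborel (\<lambda>x. \<beta> (du b x) (w x)) + integral\<^sup>L lborel (\<lambda>x. \<beta> (u x) (dw b x))"
    by (intro Bochner_Integration.integral_add Cc_integrable Cc_bilinear_left[OF \<beta>] u Cc_derivative[OF u b] C1_alongD[OF w] b)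
  ultimately show ?thesis by (simp add: eq_neg_iff_add_eq_0)
qed

lemma C1_along_translate:
  assumes "C1_along B S u du"
  shows "C1_along B {x. x + c \<in> S} (\<lambda>x. u (x + c)) (\<lambda>b x. du b (x + c))"
proof (rule C1_alongI)
  show "continuous_on {x. x + c \<in> S} (\<lambda>x. u (x + c))"
    by (rule continuous_on_compose2[OF C1_alongD(1)[OF assms]]) (auto intro: continuous_intros)
  show "continuous_on {x. x + c \<in> S} (\<lambda>x. du b (x + c))" if "b \<in> B" for b
    by (rule continuous_on_compose2[OF C1_alongD(2)[OF assms that]]) (auto intro: continuous_intros)
  show "((\<lambda>t. u (x + t *\<^sub>R b + c)) has_vector_derivative du b (x + c)) (at 0)"
    if "b \<in> B" "x \<in> {x. x + c \<in> S}" for b x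
    using C1_alongD(3)[OF assms that(1), of "x + c"] that(2) by (simp add: algebra_simps)
qed

text \<open>With second derivatives at hand both sides would be \<open>- \<integral> \<beta> u (\<partial>\<^sub>b \<partial>\<^sub>c w)\<close>.  For \<open>C\<^sup>1\<close> functions
  a translation takes the place of one derivative: the function
  \<open>F s = \<integral> \<beta> (u (x + s b)) (\<partial>\<^sub>c w x)\<close> is differentiated at \<open>0\<close> once as it stands and once after \<open>\<partial>\<^sub>c\<close> has
  been moved to \<open>u\<close> and the translation to \<open>w\<close>.\<close>

lemma integral_mixed_derivatives:
  fixes \<beta> :: "'b::euclidean_space \<Rightarrow> 'c::euclidean_space \<Rightarrow> 'd::euclidean_space"
  assumes \<beta>: "bounded_bilinear \<beta>" and u: "C1_along B UNIV u du" "Cc u"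
    and w: "C1_along B UNIV w dw" "Cc w" and b: "b \<in> B" and c: "c \<in> B"
  shows "integral\<^sup>L lborel (\<lambda>x. \<beta> (du b x) (dw c x)) = integral\<^sup>L lborel (\<lambda>x. \<beta> (du c x) (dw b x))"
proof -
  define F where "F s = integral\<^sup>L lborel (\<lambda>x. \<beta> (u (x + s *\<^sub>R b)) (dw c x))" for s
  have "(F has_vector_derivative integral\<^sup>L lborel (\<lambda>x. \<beta> (du b x) (dw c x))) (at 0)"
    unfolding F_def
    using integral_translated_derivative[OF \<beta> u b C1_alongD(2)[OF w(1) c]] .
  moreover have F_eq: "F s = - integral\<^sup>L lborel (\<lambda>x. \<beta> (du c x) (w (x + s *\<^sub>R (- b))))" for s
  proof -
    have "F s = - integral\<^sup>L lborel (\<lambda>x. \<beta> (du c (x + s *\<^sub>R b)) (w x))"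
      unfolding F_def
      using integral_by_parts[OF \<beta> C1_along_translate[OF u(1), simplified] Cc_translate[OF u(2)] w(1) c] by simp
    also have "integral\<^sup>L lborel (\<lambda>x. \<beta> (du c (x + s *\<^sub>R b)) (w x)) =
        integral\<^sup>L lborel (\<lambda>x. \<beta> (du c x) (w (x + s *\<^sub>R (- b))))"
    proof -
      have "continuous_on UNIV (\<lambda>x. \<beta> (du c x) (w (x + s *\<^sub>R (- b))))"
        by (intro bounded_bilinear.continuous_on[OF \<beta>] C1_alongD[OF u(1)] c
            CcD(1)[OF Cc_translate[OF w(2)]])
      from integral_translate[OF this, of "s *\<^sub>R b"] show ?thesis by simp
    qed
    finally show ?thesis .
  qed
  have w': "C1_along (uminus ` B) UNIV w (\<lambda>b x. - dw (- b) x)"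
  proof (rule C1_alongI)
    fix b x assume "b \<in> uminus ` B"
    then have "- b \<in> B" by auto
    from C1_along_line[OF w(1) this, of x 0]
    have "((\<lambda>t. w (x + t *\<^sub>R - b)) has_vector_derivative dw (- b) x) (at (- 0))" by simp
    from has_vector_derivative_at_within[OF this]
    have *: "((\<lambda>t. w (x + t *\<^sub>R - b)) has_vector_derivative dw (- b) x) (at (- 0) within range uminus)" .
    show "((\<lambda>t. w (x + t *\<^sub>R b)) has_vector_derivative - dw (- b) x) (at 0)"
      using vector_diff_chain_within[of uminus "-1" 0 UNIV, OF has_vector_derivative_minus[OF has_vector_derivative_id] *]
      by (simp add: o_def)
  qed (use C1_alongD[OF w(1)] in \<open>auto intro: continuous_on_minus\<close>)
  have "((\<lambda>s. integral\<^sup>L lborel (\<lambda>x. \<beta> (du c x) (w (x + s *\<^sub>R (- b))))) has_vector_derivative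
      integral\<^sup>L lborel (\<lambda>x. \<beta> (du c x) (- dw b x))) (at 0)"
    using integral_translated_derivative[OF bounded_bilinear.flip[OF \<beta>] w' w(2) _ C1_alongD(2)[OF u(1) c], of "- b"] b
    by simp
  then have "((\<lambda>s. - integral\<^sup>L lborel (\<lambda>x. \<beta> (du c x) (w (x + s *\<^sub>R (- b))))) has_vector_derivative
      - integral\<^sup>L lborel (\<lambda>x. \<beta> (du c x) (- dw b x))) (at 0)"
    by (rule has_vector_derivative_minus)
  then have "(F has_vector_derivative integral\<^sup>L lborel (\<lambda>x. \<beta> (du c x) (dw b x))) (at 0)"
    by (simp add: F_eq[abs_def] bounded_bilinear.minus_right[OF \<beta>])
  ultimately show ?thesis
    using vector_derivative_unique_at by blast
qed

lemma C1_along_zero_derivative: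
  assumes "C1_along B S u du" "open T" "T \<subseteq> S" "\<And>x. x \<in> T \<Longrightarrow> u x = 0" "b \<in> B" "x \<in> T"
  shows "du b x = 0"
proof -
  have "C1_along B T u (\<lambda>b x. 0)"
    using assms(4) by (intro C1_along_cong[OF C1_along_const[of _ _ 0] assms(2)]) auto
  then show ?thesis
    using vector_derivative_unique_at[OF C1_alongD(3)[OF assms(1,5)] C1_alongD(3)[of B T]] assms(3,5,6)
    by blast
qed

section \<open>Two auxiliary facts of real analysis\<close>

lemma Cc_eq_zero_if_integral_nonpos:
  fixes f :: "'a::euclidean_space \<Rightarrow> real"
  assumes "Cc f" "\<And>x. 0 \<le> f x" "integral\<^sup>L lborel f \<le> 0"
  shows "f x = 0"
proof -
  have "integral\<^sup>L lborel f = 0"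
    using assms(3) Bochner_Integration.integral_nonneg[OF assms(2), of lborel] by (rule order_antisym)
  then have "AE x in lborel. f x = 0"
    using integral_nonneg_eq_0_iff_AE[OF Cc_integrable[OF assms(1)]] assms(2) by simp
  have o: "open {x. f x \<noteq> 0}"
    by (intro open_Collect_neq CcD(1)[OF assms(1)] continuous_on_const)
  from \<open>AE x in lborel. f x = 0\<close> have null: "{x. f x \<noteq> 0} \<in> null_sets lborel"
    using o AE_iff_null_sets[of "{x. f x \<noteq> 0}" lborel] by simp
  then have "negligible {x. f x \<noteq> 0}"
    using null_sets_completionI negligible_iff_null_sets by blast
  then show ?thesis
    using open_not_negligible[OF o] by blast
qed

text \<open>The quotient \<open>(b - s)\<^sub>+\<^sup>2 / ((b - s)\<^sub>+\<^sup>2 + (s - a)\<^sub>+\<^sup>2)\<close>; the squares make it \<open>C\<^sup>1\<close> at \<open>a\<close> and \<open>b\<close>.\<close>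

lemma smooth_cutoff_exists:
  fixes a b :: real
  assumes "a < b"
  obtains F F' where "\<And>s. (F has_real_derivative F' s) (at s)" "continuous_on UNIV F'"
    "\<And>s. s \<le> a \<Longrightarrow> F s = 1 \<and> F' s = 0" "\<And>s. b \<le> s \<Longrightarrow> F s = 0 \<and> F' s = 0"
proof -
  have sq: "((\<lambda>s. (max 0 s)\<^sup>2) has_real_derivative 2 * max 0 s) (at s)" for s :: real
  proof -
    consider "s < 0" | "s > 0" | "s = 0" by linarith
    then show ?thesis
    proof cases
      case 1
      have "((\<lambda>s. 0) has_real_derivative 2 * max 0 s) (at s)"
        using 1 by simp
      then show ?thesis
        by (rule has_field_derivative_transform_within_open[where S = "{..<0}"]) (use 1 in auto)
    next
      case 2
      have "((\<lambda>s. s\<^sup>2) has_real_derivative 2 * max 0 s) (at s)"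
        using 2 by (auto intro!: derivative_eq_intros)
      then show ?thesis
        by (rule has_field_derivative_transform_within_open[where S = "{0<..}"]) (use 2 in auto)
    next
      case 3
      have "\<bar>(max 0 y)\<^sup>2\<bar> \<le> e * \<bar>y\<bar>" if "e > 0" "\<bar>y\<bar> < e" for e y :: real
      proof (cases "0 \<le> y")
        case True
        then have "y * y \<le> e * y" using that by (intro mult_right_mono) auto
        then show ?thesis using True by (simp add: power2_eq_square)
      next
        case False
        then have "max 0 y = 0" by simp
        then show ?thesis using that mult_nonneg_nonneg[of e "\<bar>y\<bar>"] by simp
      qed
      then have "\<forall>e>0. \<exists>d>0. \<forall>y. norm (y - s) < d \<longrightarrow>
          norm ((max 0 y)\<^sup>2 - (max 0 s)\<^sup>2 - 2 * max 0 s * (y - s)) \<le> e * norm (y - s)"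
        using 3 by auto
      then show ?thesis
        unfolding has_field_derivative_def has_derivative_at_alt
        using bounded_linear_mult_right by blast
    qed
  qed
  define p where "p s = (max 0 (b - s))\<^sup>2" for s
  define q where "q s = (max 0 (s - a))\<^sup>2" for s
  define p' where "p' s = - (2 * max 0 (b - s))" for s
  define q' where "q' s = 2 * max 0 (s - a)" for s
  have p: "(p has_real_derivative p' s) (at s)" for s
    using DERIV_chain2[OF sq DERIV_diff[OF DERIV_const DERIV_ident], of b s] by (simp add: p_def[abs_def] p'_def)
  have q: "(q has_real_derivative q' s) (at s)" for s
    using DERIV_chain2[OF sq DERIV_diff[OF DERIV_ident DERIV_const], of a s] by (simp add: q_def[abs_def] q'_def)
  have pos: "p s + q s \<noteq> 0" for s
    using assms by (auto simp: p_def q_def max_def add_nonneg_eq_0_iff)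
  define F' where "F' s = (p' s * (p s + q s) - p s * (p' s + q' s)) / ((p s + q s) * (p s + q s))" for s
  show ?thesis
  proof
    show "((\<lambda>s. p s / (p s + q s)) has_real_derivative F' s) (at s)" for s
      unfolding F'_def by (intro DERIV_divide p DERIV_add q pos)
    show "continuous_on UNIV F'"
      unfolding F'_def[abs_def]
      by (intro continuous_intros continuous_on_divide)
        (use pos in \<open>auto simp: p_def[abs_def] q_def[abs_def] p'_def[abs_def] q'_def[abs_def] intro!: continuous_intros\<close>)
    show "p s / (p s + q s) = 1 \<and> F' s = 0" if "s \<le> a" for s
    proof -
      have "q s = 0" "q' s = 0" using that by (auto simp: q_def q'_def)
      then show ?thesis using pos[of s] by (simp add: F'_def)
    qed
    show "p s / (p s + q s) = 0 \<and> F' s = 0" if "b \<le> s" for s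
      using that by (simp add: p_def p'_def F'_def)
  qed
qed

section \<open>Hyperplanes, strict derivatives and charts\<close>

lemma hyperplane_normal:
  fixes T W :: "'a::euclidean_space set"
  assumes T: "subspace T" and W: "subspace W" and sub: "T \<subseteq> W" and dim: "dim T + 1 = dim W"
  obtains \<nu> where "\<nu> \<in> W" "norm \<nu> = 1" "\<And>t. t \<in> T \<Longrightarrow> t \<bullet> \<nu> = 0"
    "\<And>w. w \<in> W \<Longrightarrow> w - (w \<bullet> \<nu>) *\<^sub>R \<nu> \<in> T"
proof -
  have "span T \<subset> span W"
    using T W sub dim by (auto simp: span_eq_iff[THEN iffD2])
  then obtain x where x: "x \<noteq> 0" "x \<in> span W" "\<And>y. y \<in> span T \<Longrightarrow> orthogonal x y"
    using orthogonal_to_subspace_exists_gen by blast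
  define \<nu> where "\<nu> = x /\<^sub>R norm x"
  have \<nu>: "\<nu> \<in> W" "norm \<nu> = 1"
    using x(1,2) W by (simp_all add: \<nu>_def span_eq_iff[THEN iffD2] subspace_scale)
  have orth: "t \<bullet> \<nu> = 0" if "t \<in> T" for t
    using x(3)[OF span_base[OF that]] by (simp add: \<nu>_def orthogonal_def inner_commute)
  have "\<nu> \<notin> span T"
    using orth[of \<nu>] \<nu>(2) T by (auto simp: span_eq_iff[THEN iffD2] norm_eq_sqrt_inner)
  then have "dim (span (insert \<nu> T)) = dim W"
    using dim by (simp add: dim_insert)
  moreover have "span (insert \<nu> T) \<subseteq> W"
    using \<nu> sub W by (intro span_minimal) auto
  ultimately have "span (insert \<nu> T) = W"
    using W by (intro subspace_dim_equal) auto
  have "w - (w \<bullet> \<nu>) *\<^sub>R \<nu> \<in> T" if "w \<in> W" for w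
  proof -
    obtain k where k: "w - k *\<^sub>R \<nu> \<in> T"
      using \<open>w \<in> W\<close> \<open>span (insert \<nu> T) = W\<close> T span_breakdown_eq[of w \<nu> T] by (auto simp: span_eq_iff[THEN iffD2])
    have "w \<bullet> \<nu> = k"
      using orth[OF k] \<nu>(2) by (simp add: inner_diff_left norm_eq_sqrt_inner)
    with k show ?thesis by simp
  qed
  with \<nu> orth show ?thesis by (intro that)
qed

text \<open>Two-point form of differentiability at \<open>a\<close>, with an error \<open>e |x - y|\<close> that is uniform in both points;
  it comes from the mean value inequality because the derivative is continuous at \<open>a\<close>.\<close>

lemma strictly_differentiable:
  fixes \<phi> :: "'a::euclidean_space \<Rightarrow> 'b::euclidean_space"
  assumes U: "open U" "a \<in> U" and diff: "\<And>x. x \<in> U \<Longrightarrow> \<phi> differentiable (at x)"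
    and cont: "\<And>v. continuous_on U (\<lambda>x. frechet_derivative \<phi> (at x) v)" and e: "0 < e"
  obtains r where "0 < r" "\<And>x y. norm (x - a) < r \<Longrightarrow> norm (y - a) < r \<Longrightarrow>
    norm (\<phi> x - \<phi> y - frechet_derivative \<phi> (at a) (x - y)) \<le> e * norm (x - y)"
proof -
  define \<phi>' where "\<phi>' x = frechet_derivative \<phi> (at x)" for x
  have \<phi>': "(\<phi> has_derivative \<phi>' x) (at x)" if "x \<in> U" for x
    using diff[OF that] by (simp add: \<phi>'_def frechet_derivative_works)
  have "\<forall>\<^sub>F x in nhds a. norm (\<phi>' x i - \<phi>' a i) < e / real DIM('a)" if "i \<in> Basis" for i
  proof -
    have "isCont (\<lambda>x. \<phi>' x i) a"
      using cont[of i] U continuous_on_eq_continuous_at unfolding \<phi>'_def by blast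
    then have "((\<lambda>x. \<phi>' x i) \<longlongrightarrow> \<phi>' a i) (nhds a)"
      using tendsto_at_iff_tendsto_nhds[of "\<lambda>x. \<phi>' x i" a] by (simp add: isCont_def)
    from tendstoD[OF this, of "e / real DIM('a)"] show ?thesis
      using e by (simp add: dist_norm)
  qed
  then have "\<forall>\<^sub>F x in nhds a. \<forall>i\<in>Basis. norm (\<phi>' x i - \<phi>' a i) < e / real DIM('a)"
    by (intro eventually_ball_finite) auto
  moreover have "\<forall>\<^sub>F x in nhds a. x \<in> U"
    using U eventually_nhds_in_open by blast
  ultimately have "\<forall>\<^sub>F x in nhds a. x \<in> U \<and> (\<forall>i\<in>Basis. norm (\<phi>' x i - \<phi>' a i) < e / real DIM('a))"
    by eventually_elim simp
  then obtain r where r: "0 < r" "\<And>x. dist x a < r \<Longrightarrow> x \<in> U \<and> (\<forall>i\<in>Basis. norm (\<phi>' x i - \<phi>' a i) < e / real DIM('a))"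
    unfolding eventually_nhds_metric by blast
  have lin: "linear (\<phi>' x)" if "x \<in> U" for x
    using \<phi>'[OF that] has_derivative_linear by blast
  have bound: "onorm (\<phi>' x - \<phi>' a) \<le> e" if "dist x a < r" for x
  proof (rule onorm_le)
    fix v
    have x: "x \<in> U" using r(2)[OF that] by blast
    have l: "linear (\<phi>' x - \<phi>' a)"
      using linear_compose_sub[OF lin[OF x] lin[OF U(2)]] by (simp add: fun_diff_def)
    have "(\<phi>' x - \<phi>' a) v = (\<phi>' x - \<phi>' a) (\<Sum>i\<in>Basis. (v \<bullet> i) *\<^sub>R i)"
      by (simp add: euclidean_representation)
    also have "\<dots> = (\<Sum>i\<in>Basis. (\<phi>' x - \<phi>' a) ((v \<bullet> i) *\<^sub>R i))"
      by (rule linear_sum[OF l])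
    also have "\<dots> = (\<Sum>i\<in>Basis. (v \<bullet> i) *\<^sub>R (\<phi>' x - \<phi>' a) i)"
      by (simp only: linear_scale[OF l])
    also have "norm \<dots> \<le> (\<Sum>i\<in>(Basis :: 'a set). norm v * (e / real DIM('a)))"
    proof (rule sum_norm_le)
      fix i :: 'a assume i: "i \<in> Basis"
      have "\<bar>v \<bullet> i\<bar> \<le> norm v" using i by (rule Basis_le_norm)
      moreover have "norm ((\<phi>' x - \<phi>' a) i) \<le> e / real DIM('a)"
        using r(2)[OF that] i by (simp add: fun_diff_def less_imp_le)
      ultimately show "norm ((v \<bullet> i) *\<^sub>R (\<phi>' x - \<phi>' a) i) \<le> norm v * (e / real DIM('a))"
        unfolding norm_scaleR by (intro mult_mono) auto
    qed
    also have "\<dots> = e * norm v" by simp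
    finally show "norm ((\<phi>' x - \<phi>' a) v) \<le> e * norm v" .
  qed
  show ?thesis
  proof (rule that[OF r(1)])
    fix x y assume xy: "norm (x - a) < r" "norm (y - a) < r"
    have "norm (\<phi> x - \<phi> y - \<phi>' a (x - y)) \<le> norm (x - y) * e"
    proof (rule differentiable_bound_linearization[where S = "ball a r" and f' = \<phi>'])
      show "y + t *\<^sub>R (x - y) \<in> ball a r" if "t \<in> {0..1}" for t
      proof -
        have "(1 - t) *\<^sub>R y + t *\<^sub>R x \<in> ball a r"
          using that xy by (intro convexD_alt) (auto simp: dist_norm norm_minus_commute)
        then show ?thesis by (simp add: algebra_simps)
      qed
      show "(\<phi> has_derivative \<phi>' z) (at z within ball a r)" if "z \<in> ball a r" for z
        using that r(2)[of z] by (auto intro: has_derivative_at_withinI \<phi>' simp: dist_commute)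
      show "onorm (\<phi>' z - \<phi>' a) \<le> e" if "z \<in> ball a r" for z
        using that by (intro bound) (simp add: dist_commute)
      show "a \<in> ball a r" using r(1) by simp
    qed
    then show "norm (\<phi> x - \<phi> y - frechet_derivative \<phi> (at a) (x - y)) \<le> e * norm (x - y)"
      by (simp add: \<phi>'_def mult.commute)
  qed
qed

lemma inverse_derivative:
  assumes U: "open U" "x \<in> U" and inv: "\<And>y. y \<in> U \<Longrightarrow> \<psi> (\<phi> y) = y"
    and \<phi>: "(\<phi> has_derivative A) (at x)" and \<psi>: "(\<psi> has_derivative E) (at (\<phi> x))"
  shows "E (A v) = v"
proof -
  have "((\<lambda>y. \<psi> (\<phi> y)) has_derivative (\<lambda>v. E (A v))) (at x)"
    using has_derivative_compose[OF \<phi> \<psi>] .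
  moreover have "((\<lambda>y. \<psi> (\<phi> y)) has_derivative (\<lambda>v. v)) (at x)"
    by (rule has_derivative_transform_within_open[OF has_derivative_ident U]) (simp add: inv)
  ultimately have "(\<lambda>v. E (A v)) = (\<lambda>v. v)"
    by (rule has_derivative_unique)
  then show ?thesis by metis
qed

lemma smooth_onD:
  assumes "smooth_on f U"
  shows "x \<in> U \<Longrightarrow> f differentiable (at x)"
    "continuous_on U (\<lambda>x. frechet_derivative f (at x) v)"
proof -
  have "Ck_on (Suc 0) f U" using assms by (auto simp: smooth_on_def)
  then show "x \<in> U \<Longrightarrow> f differentiable (at x)"
    "continuous_on U (\<lambda>x. frechet_derivative f (at x) v)" by auto
qed

section \<open>A Carleman estimate for Dirac operators\<close>

text \<open>\<open>L b\<close> stands for left multiplication by \<open>b\<close>.  Polarising \<open>norm_L\<close> gives the Clifford-type relation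
  \<open>inner_L_polar\<close>, from which the antisymmetry of the angular part of \<open>D\<close> and with it the estimates derive.\<close>

locale dirac =
  fixes B :: "'a::euclidean_space set" and L :: "'a \<Rightarrow> 'b::euclidean_space \<Rightarrow> 'b"
  assumes finite_B: "finite B"
    and orthonormal: "\<And>b c. b \<in> B \<Longrightarrow> c \<in> B \<Longrightarrow> b \<bullet> c = (if b = c then 1 else 0)"
    and bilinear: "bounded_bilinear L"
    and norm_L: "\<And>a x. norm (L a x) = norm a * norm x"
begin

interpretation L: bounded_bilinear L by (rule bilinear)

definition proj :: "'a \<Rightarrow> 'a" where "proj x = (\<Sum>b\<in>B. (x \<bullet> b) *\<^sub>R b)"

text \<open>The squared length of the component of \<open>x\<close> in the slice space, see \<open>proj_inner_self\<close>.\<close>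

definition sq :: "'a \<Rightarrow> real" where "sq x = (\<Sum>b\<in>B. (x \<bullet> b)\<^sup>2)"

definition euler :: "('a \<Rightarrow> 'a \<Rightarrow> 'b) \<Rightarrow> 'a \<Rightarrow> 'b" where
  "euler du x = (\<Sum>b\<in>B. (x \<bullet> b) *\<^sub>R du b x)"

definition D :: "('a \<Rightarrow> 'a \<Rightarrow> 'b) \<Rightarrow> 'a \<Rightarrow> 'b" where
  "D du x = (\<Sum>b\<in>B. L b (du b x))"

text \<open>Write \<open>A\<close> for \<open>L (proj x)\<close> and \<open>R\<close> for the Euler field \<open>euler\<close>.  Then \<open>A\<^sup>T D = R + \<Gamma>\<close> is the
  decomposition of the Dirac operator into its radial part and the angular operator \<open>\<Gamma>\<close>, which
  differentiates along spheres.  The term \<open>angular du x y\<close> is the inner product of \<open>y\<close> with \<open>\<Gamma> u\<close>,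
  written without the adjoint of \<open>A\<close>.\<close>

definition angular :: "('a \<Rightarrow> 'a \<Rightarrow> 'b) \<Rightarrow> 'a \<Rightarrow> 'b \<Rightarrow> real" where
  "angular du x y = L (proj x) y \<bullet> D du x - y \<bullet> euler du x"

text \<open>The bilinear form of the matrix \<open>(L a)\<^sup>T (L b) - (a \<bullet> b)\<close>.  It is antisymmetric in \<open>x, y\<close>
  (\<open>twist_swap\<close>); these forms are the coefficients of \<open>\<Gamma>\<close> (\<open>angular_eq\<close>).\<close>

definition twist :: "'a \<Rightarrow> 'a \<Rightarrow> 'b \<Rightarrow> 'b \<Rightarrow> real" where
  "twist a b x y = L a x \<bullet> L b y - (a \<bullet> b) * (x \<bullet> y)"

abbreviation n :: real where "n \<equiv> real (card B)"

lemma inner_L: "L a x \<bullet> L a y = (a \<bullet> a) * (x \<bullet> y)"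
proof -
  have *: "L a z \<bullet> L a z = (a \<bullet> a) * (z \<bullet> z)" for z
    using norm_L[of a z] by (simp add: norm_eq_sqrt_inner real_sqrt_mult[symmetric] del: real_sqrt_mult)
  show ?thesis
    using *[of "x + y"] *[of x] *[of y]
    by (simp add: L.add_right inner_add_left inner_add_right inner_commute[of y x]
        inner_commute[of "L a y" "L a x"] distrib_left)
qed

lemma inner_L_polar: "L a x \<bullet> L b y + L b x \<bullet> L a y = 2 * (a \<bullet> b) * (x \<bullet> y)"
  using inner_L[of "a + b" x y] inner_L[of a x y] inner_L[of b x y]
  by (simp add: L.add_left inner_add_left inner_add_right inner_commute[of b a] algebra_simps)

lemma twist_swap: "twist a b y x = - twist a b x y"
  using inner_L_polar[of a x b y] unfolding twist_def
  by (simp add: inner_commute[of y x] inner_commute[of "L a y" "L b x"] algebra_simps)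

lemma twist_same: "twist a a x y = 0"
  by (simp add: twist_def inner_L)

lemma bilinear_twist: "bounded_bilinear (twist a b)"
  unfolding bilinear_conv_bounded_bilinear[symmetric] bilinear_def linear_iff
  by (simp add: twist_def L.add_right L.scaleR_right inner_add_left inner_add_right algebra_simps)

lemma sum_delta_B: "a \<in> B \<Longrightarrow> (\<Sum>b\<in>B. (a \<bullet> b) * f b) = (f a :: real)"
proof -
  assume a: "a \<in> B"
  have "(\<Sum>b\<in>B. (a \<bullet> b) * f b) = (\<Sum>b\<in>B. if a = b then f b else 0)"
    by (rule sum.cong) (simp_all add: orthonormal[OF a])
  then show ?thesis using a finite_B by (simp add: sum.delta')
qed

lemma angular_eq: "angular du x y = (\<Sum>a\<in>B. \<Sum>b\<in>B. (x \<bullet> a) * twist a b y (du b x))"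
proof -
  have "L (proj x) y = (\<Sum>a\<in>B. (x \<bullet> a) *\<^sub>R L a y)"
    by (simp add: proj_def L.sum_left L.scaleR_left)
  then have "L (proj x) y \<bullet> D du x = (\<Sum>a\<in>B. \<Sum>b\<in>B. (x \<bullet> a) * (L a y \<bullet> L b (du b x)))"
    by (simp add: D_def inner_sum_left) (simp add: inner_sum_right sum_distrib_left)
  moreover have "y \<bullet> euler du x = (\<Sum>a\<in>B. \<Sum>b\<in>B. (x \<bullet> a) * ((a \<bullet> b) * (y \<bullet> du b x)))"
    by (simp add: euler_def inner_sum_right sum_delta_B flip: sum_distrib_left)
  ultimately show ?thesis
    by (simp add: angular_def twist_def right_diff_distrib flip: sum_subtractf)
qed

lemma angular_add: "angular du x (y + z) = angular du x y + angular du x z"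
  by (simp add: angular_def L.add_right inner_add_left)

lemma angular_scaleR: "angular du x (c *\<^sub>R y) = c * angular du x y"
  by (simp add: angular_def L.scaleR_right right_diff_distrib)

lemma proj_inner_self: "proj x \<bullet> proj x = sq x"
proof -
  have "proj x \<bullet> proj x = (\<Sum>a\<in>B. \<Sum>b\<in>B. (x \<bullet> a) * ((a \<bullet> b) * (x \<bullet> b)))"
    by (simp add: proj_def inner_sum_left) (simp add: inner_sum_right sum_distrib_left mult_ac)
  also have "\<dots> = sq x"
    by (simp add: sq_def sum_delta_B power2_eq_square flip: sum_distrib_left)
  finally show ?thesis .
qed

lemma sq_nonneg: "0 \<le> sq x"
  by (simp add: sq_def sum_nonneg)

lemma norm_proj: "norm (proj x) = sqrt (sq x)"
  by (simp add: norm_eq_sqrt_inner proj_inner_self)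

lemma continuous_proj: "continuous_on S proj"
  unfolding proj_def[abs_def] by (intro continuous_intros)

lemma continuous_sq: "continuous_on S sq"
  unfolding sq_def[abs_def] by (intro continuous_intros)

lemma continuous_D: "C1_along B S u du \<Longrightarrow> continuous_on S (D du)"
  unfolding D_def[abs_def]
  by (intro continuous_on_sum L.continuous_on continuous_on_const) (auto intro: C1_alongD)

lemma C1_sq: "C1_along B S sq (\<lambda>b x. 2 * (x \<bullet> b))"
proof -
  have "C1_along B S (\<lambda>x. \<Sum>c\<in>B. (x \<bullet> c) * (x \<bullet> c)) (\<lambda>b x. \<Sum>c\<in>B. (b \<bullet> c) * (x \<bullet> c) + (x \<bullet> c) * (b \<bullet> c))"
    by (intro C1_along_sum C1_along_bilinear[OF bounded_bilinear_mult] C1_along_inner)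
  moreover have "(\<Sum>c\<in>B. (b \<bullet> c) * (x \<bullet> c) + (x \<bullet> c) * (b \<bullet> c)) = 2 * (x \<bullet> b)" if "b \<in> B" for b x
    using sum_delta_B[OF that, of "\<lambda>c. x \<bullet> c"] by (simp add: sum.distrib mult.commute[of "x \<bullet> _"] flip: sum_distrib_left)
  ultimately show ?thesis
    by (auto simp: C1_along_def sq_def[abs_def] power2_eq_square cong: continuous_on_cong)
qed

lemma Cc_euler:
  assumes v: "C1_along B UNIV v dv" "Cc v"
  shows "Cc (euler dv)" "Cc (D dv)"
  unfolding euler_def[abs_def] D_def[abs_def]
  by (auto intro!: Cc_sum Cc_scaleR_right Cc_bilinear_right[OF bilinear] Cc_derivative[OF v] continuous_intros)

lemma Cc_angular:
  assumes v: "C1_along B UNIV v dv" "Cc v" and w: "Cc w"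
  shows "Cc (\<lambda>x. angular dv x (w x))"
  unfolding angular_def
  by (intro Cc_diff Cc_bilinear_right[OF bounded_bilinear_inner] Cc_euler[OF v] L.continuous_on
      continuous_proj CcD(1)[OF w])

text \<open>The divergence of the field \<open>f x\<close> in the directions of \<open>B\<close> has integral zero.\<close>

lemma integral_euler:
  fixes f :: "'a \<Rightarrow> real"
  assumes f: "C1_along B UNIV f df" "Cc f"
  shows "integral\<^sup>L lborel (\<lambda>x. (\<Sum>b\<in>B. (x \<bullet> b) * df b x) + n * f x) = 0"
proof -
  have C: "Cc (\<lambda>x. (b \<bullet> b) * f x + (x \<bullet> b) * df b x)" if "b \<in> B" for b
    by (intro Cc_add Cc_mult_right f Cc_derivative[OF f that] continuous_intros)
  have "integral\<^sup>L lborel (\<lambda>x. (\<Sum>b\<in>B. (x \<bullet> b) * df b x) + n * f x) =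
      integral\<^sup>L lborel (\<lambda>x. \<Sum>b\<in>B. (b \<bullet> b) * f x + (x \<bullet> b) * df b x)"
    by (simp add: sum.distrib orthonormal add.commute)
  also have "\<dots> = (\<Sum>b\<in>B. integral\<^sup>L lborel (\<lambda>x. (b \<bullet> b) * f x + (x \<bullet> b) * df b x))"
    by (rule Bochner_Integration.integral_sum) (rule Cc_integrable[OF C])
  also have "\<dots> = 0"
  proof (rule sum.neutral, rule ballI)
    fix b assume b: "b \<in> B"
    show "integral\<^sup>L lborel (\<lambda>x. (b \<bullet> b) * f x + (x \<bullet> b) * df b x) = 0"
      using integral_derivative_zero[OF C1_along_bilinear[OF bounded_bilinear_mult C1_along_inner[of B UNIV b] f(1)] _ b]
        Cc_mult_right[OF _ f(2), of "\<lambda>x. x \<bullet> b"]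
      by (simp add: continuous_intros)
  qed
  finally show ?thesis .
qed

text \<open>The angular operator \<open>\<Gamma>\<close> is symmetric and commutes with \<open>R\<close>, whose adjoint is \<open>- R - n\<close>; hence
  \<open>\<integral> R v \<bullet> \<Gamma> v = - \<integral> \<Gamma> v \<bullet> R v - n \<integral> v \<bullet> \<Gamma> v\<close>.  Since \<open>v\<close> is only \<open>C\<^sup>1\<close>, the commutation is carried out
  by \<open>integral_mixed_derivatives\<close>, applied under the form \<open>twist a b\<close> to \<open>(x \<bullet> a) (x \<bullet> c) v\<close> and \<open>v\<close> with
  the directions \<open>b\<close> and \<open>c\<close>, and summed over \<open>a, b, c\<close>.\<close>

lemma integral_angular:
  assumes v: "C1_along B UNIV v dv" "Cc v"
  shows "integral\<^sup>L lborel (\<lambda>x. 2 * angular dv x (euler dv x) + n * angular dv x (v x)) = 0"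
proof -
  define U where "U a c x = ((x \<bullet> a) * (x \<bullet> c)) *\<^sub>R v x" for a c x
  define dU where "dU a c k x = ((k \<bullet> a) * (x \<bullet> c) + (x \<bullet> a) * (k \<bullet> c)) *\<^sub>R v x + ((x \<bullet> a) * (x \<bullet> c)) *\<^sub>R dv k x"
    for a c k x
  define I where "I a b c x = twist a b (dU a c c x) (dv b x) - twist a b (dU a c b x) (dv c x)" for a b c x
  have U: "C1_along B UNIV (U a c) (dU a c)" for a c
    unfolding U_def[abs_def] dU_def[abs_def]
    by (intro C1_along_scaleR v C1_along_bilinear[OF bounded_bilinear_mult] C1_along_inner)
  have CU: "Cc (U a c)" for a c
    unfolding U_def[abs_def] by (intro Cc_scaleR_right v continuous_intros)
  have C: "Cc (\<lambda>x. twist a b (dU a c k x) (dv l x))" if "k \<in> B" "l \<in> B" for a b c k l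
    by (rule Cc_bilinear_left[OF bilinear_twist Cc_derivative[OF U CU that(1)] C1_alongD(2)[OF v(1) that(2)]])
  have I0: "integral\<^sup>L lborel (I a b c) = 0" if "a \<in> B" "b \<in> B" "c \<in> B" for a b c
    using integral_mixed_derivatives[OF bilinear_twist U CU v that(3,2)]
      Bochner_Integration.integral_diff[OF Cc_integrable[OF C] Cc_integrable[OF C]] that
    by (simp add: I_def[abs_def])
  have CI: "Cc (I a b c)" if "b \<in> B" "c \<in> B" for a b c
    unfolding I_def[abs_def] by (intro Cc_diff C that)
  have "2 * angular dv x (euler dv x) + n * angular dv x (v x) = (\<Sum>a\<in>B. \<Sum>b\<in>B. \<Sum>c\<in>B. I a b c x)" for x
  proof -
    interpret t: bounded_bilinear "twist a b" for a b by (rule bilinear_twist)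
    \<comment> \<open>differentiating \<open>x \<bullet> c\<close> along \<open>c\<close> and summing over \<open>c\<close> produces the dimension \<open>n\<close>\<close>
    have 1: "(\<Sum>c\<in>B. twist a b (dU a c c x) (dv b x)) =
        (x \<bullet> a) * ((n + 1) * twist a b (v x) (dv b x) + twist a b (euler dv x) (dv b x))" if "a \<in> B" for a b
    proof -
      have "(\<Sum>c\<in>B. twist a b (dU a c c x) (dv b x)) = (\<Sum>c\<in>B. (a \<bullet> c) * ((x \<bullet> c) * twist a b (v x) (dv b x)))
         + (\<Sum>c\<in>B. (x \<bullet> a) * twist a b (v x) (dv b x)) + (x \<bullet> a) * (\<Sum>c\<in>B. (x \<bullet> c) * twist a b (dv c x) (dv b x))"
        by (simp add: dU_def t.add_left t.scaleR_left sum.distrib orthonormal sum_distrib_left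
            distrib_right distrib_left inner_commute[of _ a] mult_ac)
      then show ?thesis
        by (simp add: sum_delta_B[OF that] euler_def t.sum_left t.scaleR_left algebra_simps)
    qed
    have 2: "(\<Sum>b\<in>B. twist a b (dU a c b x) (dv c x)) =
        (x \<bullet> a) * twist a c (v x) (dv c x) - (\<Sum>b\<in>B. (x \<bullet> a) * ((x \<bullet> c) * twist a b (dv c x) (dv b x)))"
      if "a \<in> B" "c \<in> B" for a c
    proof -
      have "(\<Sum>b\<in>B. twist a b (dU a c b x) (dv c x)) = (\<Sum>b\<in>B. (a \<bullet> b) * ((x \<bullet> c) * twist a b (v x) (dv c x)))
         + (\<Sum>b\<in>B. (c \<bullet> b) * ((x \<bullet> a) * twist a b (v x) (dv c x)))
         + (\<Sum>b\<in>B. (x \<bullet> a) * ((x \<bullet> c) * twist a b (dv b x) (dv c x)))"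
        by (simp add: dU_def t.add_left t.scaleR_left sum.distrib
            distrib_right distrib_left inner_commute[of _ a] inner_commute[of _ c] mult_ac)
      then show ?thesis
        by (simp add: sum_delta_B[OF that(1)] sum_delta_B[OF that(2)] twist_same twist_swap[of a _ "dv c x"] sum_negf)
    qed
    have "(\<Sum>a\<in>B. \<Sum>b\<in>B. \<Sum>c\<in>B. I a b c x) =
       (\<Sum>a\<in>B. \<Sum>b\<in>B. \<Sum>c\<in>B. twist a b (dU a c c x) (dv b x)) -
       (\<Sum>a\<in>B. \<Sum>c\<in>B. \<Sum>b\<in>B. twist a b (dU a c b x) (dv c x))"
      by (simp add: I_def sum_subtractf sum.swap[of "\<lambda>b c. twist _ b (dU _ c b x) (dv c x)" B B])
    also have "\<dots> = (\<Sum>a\<in>B. \<Sum>b\<in>B. (x \<bullet> a) * ((n + 1) * twist a b (v x) (dv b x) + twist a b (euler dv x) (dv b x)))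
       - (\<Sum>a\<in>B. (\<Sum>c\<in>B. (x \<bullet> a) * twist a c (v x) (dv c x))
           - (\<Sum>b\<in>B. \<Sum>c\<in>B. (x \<bullet> a) * ((x \<bullet> c) * twist a b (dv c x) (dv b x))))"
      by (simp add: 1 2 sum_subtractf sum.swap[of "\<lambda>b c. (x \<bullet> _) * ((x \<bullet> c) * twist _ b (dv c x) (dv b x))" B B])
    also have "\<dots> = (n + 1) * angular dv x (v x) + angular dv x (euler dv x) - (angular dv x (v x) - angular dv x (euler dv x))"
      by (simp add: angular_eq distrib_left sum.distrib sum_subtractf sum_distrib_left mult_ac)
        (simp add: euler_def t.sum_left t.scaleR_left sum_distrib_left mult_ac)
    finally show ?thesis by (simp add: algebra_simps)
  qed
  then show ?thesis
    by (simp add: Bochner_Integration.integral_sum Cc_integrable CI Cc_sum I0)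
qed

text \<open>In the notation of \<open>angular\<close>, put \<open>E = D v - \<mu> A v\<close> and \<open>m = \<mu> |proj x|\<^sup>2\<close>, so that
  \<open>A\<^sup>T E = R v + \<Gamma> v - m v\<close>.  Testing with \<open>y = R v + (n / 2) v\<close> and using
  \<open>2 (A y \<bullet> E) \<le> |y|\<^sup>2 + |proj x|\<^sup>2 |E|\<^sup>2\<close> leaves exactly the combination of \<open>R v \<bullet> \<Gamma> v\<close> and \<open>v \<bullet> \<Gamma> v\<close> that
  \<open>integral_angular\<close> annihilates.\<close>

lemma pointwise_estimate:
  "2 * angular dv x (euler dv x) + n * angular dv x (v x)
     - (2 * (\<mu> * sq x) * (euler dv x \<bullet> v x) + n * (\<mu> * sq x) * (v x \<bullet> v x)) - n\<^sup>2 / 4 * (v x \<bullet> v x)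
   \<le> sq x * (norm (D dv x - \<mu> *\<^sub>R L (proj x) (v x)))\<^sup>2"
proof -
  define y where "y = euler dv x + (n / 2) *\<^sub>R v x"
  define E where "E = D dv x - \<mu> *\<^sub>R L (proj x) (v x)"
  have "2 * (L (proj x) y \<bullet> E) \<le> 2 * ((norm (proj x) * norm E) * norm y)"
    using norm_cauchy_schwarz[of "L (proj x) y" E] by (simp add: norm_L mult_ac)
  also have "\<dots> \<le> (norm (proj x) * norm E)\<^sup>2 + (norm y)\<^sup>2"
    using sum_squares_bound[of "norm (proj x) * norm E" "norm y"] by simp
  also have "\<dots> = sq x * (norm E)\<^sup>2 + y \<bullet> y"
    by (simp add: power_mult_distrib power2_norm_eq_inner proj_inner_self)
  finally have "2 * (L (proj x) y \<bullet> E) - y \<bullet> y \<le> sq x * (norm E)\<^sup>2" by simp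
  moreover have "L (proj x) y \<bullet> E = angular dv x y + y \<bullet> euler dv x - \<mu> * sq x * (y \<bullet> v x)"
    by (simp add: E_def angular_def inner_diff_right inner_L proj_inner_self)
  moreover have "angular dv x y = angular dv x (euler dv x) + n / 2 * angular dv x (v x)"
    by (simp add: y_def angular_add angular_scaleR)
  moreover have "2 * (y \<bullet> euler dv x) - y \<bullet> y = euler dv x \<bullet> euler dv x - n\<^sup>2 / 4 * (v x \<bullet> v x)"
    by (simp add: y_def inner_add_left inner_add_right inner_commute[of "v x" "euler dv x"] power2_eq_square algebra_simps)
  moreover have "y \<bullet> v x = euler dv x \<bullet> v x + n / 2 * (v x \<bullet> v x)"
    by (simp add: y_def inner_add_left)
  ultimately have "2 * angular dv x (euler dv x) + n * angular dv x (v x)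
     - (2 * (\<mu> * sq x) * (euler dv x \<bullet> v x) + n * (\<mu> * sq x) * (v x \<bullet> v x)) - n\<^sup>2 / 4 * (v x \<bullet> v x)
     + euler dv x \<bullet> euler dv x \<le> sq x * (norm E)\<^sup>2"
    by (simp add: algebra_simps)
  then show ?thesis
    using inner_ge_zero[of "euler dv x"] unfolding E_def by linarith
qed

lemma open_sq: "open {x. c < sq x}" "open {x. sq x < c}"
  by (auto intro!: open_Collect_less continuous_sq continuous_intros)

text \<open>The weights below blow up where \<open>sq x = 0\<close>, but they only multiply functions that vanish near
  that set.\<close>

lemma continuous_on_mult_vanishing:
  fixes w g :: "'a \<Rightarrow> real"
  assumes "continuous_on {x. 0 < sq x} w" "continuous_on UNIV g" "0 < \<delta>" "\<And>x. sq x < \<delta> \<Longrightarrow> g x = 0"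
  shows "continuous_on UNIV (\<lambda>x. w x * g x)"
proof -
  have "continuous_on {x. sq x < \<delta>} (\<lambda>x. w x * g x)"
    using assms(4) by (intro continuous_on_eq[OF continuous_on_const[of _ 0]]) simp
  moreover have "continuous_on {x. 0 < sq x} (\<lambda>x. w x * g x)"
    using assms by (auto intro: continuous_on_mult continuous_on_subset)
  ultimately have "continuous_on ({x. 0 < sq x} \<union> {x. sq x < \<delta>}) (\<lambda>x. w x * g x)"
    by (intro continuous_on_open_Un open_sq)
  moreover have "{x. 0 < sq x} \<union> {x. sq x < \<delta>} = UNIV"
    using assms(3) by auto
  ultimately show ?thesis by simp
qed

lemma Cc_mult_vanishing:
  fixes w g :: "'a \<Rightarrow> real"
  assumes "continuous_on {x. 0 < sq x} w" "Cc g" "0 < \<delta>" "\<And>x. sq x < \<delta> \<Longrightarrow> g x = 0"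
  shows "Cc (\<lambda>x. w x * g x)"
  using continuous_on_mult_vanishing[OF assms(1) CcD(1)[OF assms(2)] assms(3,4)] CcD(2)[OF assms(2)]
  unfolding Cc_def by fastforce

lemma C1_along_paste_vanishing:
  assumes "C1_along B {x. 0 < sq x} f df" "0 < \<delta>"
    "\<And>x. sq x < \<delta> \<Longrightarrow> f x = 0" "\<And>b x. b \<in> B \<Longrightarrow> sq x < \<delta> \<Longrightarrow> df b x = 0"
  shows "C1_along B UNIV f df"
proof -
  have "C1_along B {x. sq x < \<delta>} f df"
    using assms(3,4) by (intro C1_along_cong[OF C1_along_const[of _ _ 0] open_sq(2)]) auto
  from C1_along_Un[OF assms(1) this open_sq]
  have "C1_along B ({x. 0 < sq x} \<union> {x. sq x < \<delta>}) f df" .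
  moreover have "{x. 0 < sq x} \<union> {x. sq x < \<delta>} = UNIV"
    using assms(2) by auto
  ultimately show ?thesis by simp
qed

text \<open>With \<open>\<rho> = sq x\<close> and \<open>v = exp (t / \<rho>) u\<close> one has \<open>exp (t / \<rho>) D u = D v - \<mu> A v\<close> for
  \<open>\<mu> = - 2 t / \<rho>\<^sup>2\<close>, so \<open>pointwise_estimate\<close> applies with \<open>m = - 2 t / \<rho>\<close>.  After integration the
  angular terms disappear by \<open>integral_angular\<close>, and \<open>integral_euler\<close> for the function \<open>m |v|\<^sup>2\<close> turns
  the two terms with \<open>m\<close> into \<open>(R m) |v|\<^sup>2 = (4 t / \<rho>) |v|\<^sup>2\<close>.  This is the gain: \<open>m\<close> increases with the
  distance.\<close>

lemma carleman:
  assumes u: "C1_along B UNIV u du" "Cc u" and \<delta>: "0 < \<delta>" "\<And>x. sq x < \<delta> \<Longrightarrow> u x = 0"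
  shows "integral\<^sup>L lborel (\<lambda>x. ((4 * t / sq x - n\<^sup>2 / 4) * (exp (t / sq x))\<^sup>2) * (u x \<bullet> u x))
    \<le> integral\<^sup>L lborel (\<lambda>x. (sq x * (exp (t / sq x))\<^sup>2) * (D du x \<bullet> D du x))" (is "?l \<le> ?r")
proof -
  let ?P = "{x. 0 < sq x}"
  have du0: "du b x = 0" if "b \<in> B" "sq x < \<delta>" for b x
    using C1_along_zero_derivative[OF u(1) open_sq(2)[of \<delta>] _ _ that(1)] \<delta>(2) that(2) by simp
  have Du0: "D du x = 0" if "sq x < \<delta>" for x
    using du0[OF _ that] by (simp add: D_def L.zero_right)
  define v where "v x = exp (t / sq x) *\<^sub>R u x" for x
  define dv where "dv b x = (exp (t / sq x) * (- (t / (sq x)\<^sup>2)) * (2 * (x \<bullet> b))) *\<^sub>R u x + exp (t / sq x) *\<^sub>R du b x" for b x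
  have "C1_along B ?P (\<lambda>x. exp (t / sq x)) (\<lambda>b x. exp (t / sq x) * (- (t / (sq x)\<^sup>2)) * (2 * (x \<bullet> b)))"
    by (rule C1_along_real_compose[OF C1_sq, where T = "{0<..}" and F = "\<lambda>s. exp (t / s)"])
       (auto intro!: derivative_eq_intros continuous_intros simp: power2_eq_square)
  from C1_along_scaleR[OF this C1_along_subset[OF u(1)]]
  have v: "C1_along B UNIV v dv"
    using \<delta> du0 unfolding v_def[abs_def] dv_def[abs_def]
    by (intro C1_along_paste_vanishing[where \<delta> = \<delta>]) auto
  have v0: "v x = 0" if "sq x < \<delta>" for x
    using \<delta>(2)[OF that] by (simp add: v_def)
  have Cv: "Cc v"
    using CcD(2)[OF u(2)] C1_alongD(1)[OF v] by (auto simp: Cc_def v_def)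
  define m where "m x = - (2 * t / sq x)" for x
  have "C1_along B ?P m (\<lambda>b x. (2 * t / (sq x)\<^sup>2) * (2 * (x \<bullet> b)))"
    unfolding m_def[abs_def]
    by (rule C1_along_real_compose[OF C1_sq, where T = "{0<..}" and F = "\<lambda>s. - (2 * t / s)"])
       (auto intro!: derivative_eq_intros continuous_intros simp: power2_eq_square)
  from C1_along_bilinear[OF bounded_bilinear_mult this C1_along_subset[OF C1_along_bilinear[OF bounded_bilinear_inner v v]]]
  have f: "C1_along B UNIV (\<lambda>x. m x * (v x \<bullet> v x)) (\<lambda>b x. (2 * t / (sq x)\<^sup>2) * (2 * (x \<bullet> b)) * (v x \<bullet> v x)
      + m x * (dv b x \<bullet> v x + v x \<bullet> dv b x))"
    using \<delta> v0 by (intro C1_along_paste_vanishing[where \<delta> = \<delta>]) auto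
  have Cf: "Cc (\<lambda>x. m x * (v x \<bullet> v x))"
    using CcD(2)[OF Cv] C1_alongD(1)[OF f] by (fastforce simp: Cc_def)
  define G where "G x = 2 * m x * (euler dv x \<bullet> v x) + n * m x * (v x \<bullet> v x) + 4 * t / sq x * (v x \<bullet> v x)" for x
  have G: "(\<Sum>b\<in>B. (x \<bullet> b) * ((2 * t / (sq x)\<^sup>2) * (2 * (x \<bullet> b)) * (v x \<bullet> v x)
      + m x * (dv b x \<bullet> v x + v x \<bullet> dv b x))) + n * (m x * (v x \<bullet> v x)) = G x" for x
  proof -
    have "(\<Sum>b\<in>B. (x \<bullet> b) * ((2 * t / (sq x)\<^sup>2) * (2 * (x \<bullet> b)) * (v x \<bullet> v x)
      + m x * (dv b x \<bullet> v x + v x \<bullet> dv b x)))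
      = (4 * t / (sq x)\<^sup>2 * (v x \<bullet> v x)) * sq x + 2 * m x * (euler dv x \<bullet> v x)"
    proof -
      have "(\<Sum>b\<in>B. (x \<bullet> b) * ((2 * t / (sq x)\<^sup>2) * (2 * (x \<bullet> b)) * (v x \<bullet> v x)
          + m x * (dv b x \<bullet> v x + v x \<bullet> dv b x)))
        = (\<Sum>b\<in>B. 4 * t / (sq x)\<^sup>2 * (v x \<bullet> v x) * (x \<bullet> b)\<^sup>2 + 2 * m x * ((x \<bullet> b) * (dv b x \<bullet> v x)))"
        by (intro sum.cong refl)
          (simp add: inner_commute[of "v x" "dv _ x"] power2_eq_square[of "x \<bullet> _"] algebra_simps)
      also have "\<dots> = (4 * t / (sq x)\<^sup>2 * (v x \<bullet> v x)) * (\<Sum>b\<in>B. (x \<bullet> b)\<^sup>2)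
          + 2 * m x * (\<Sum>b\<in>B. (x \<bullet> b) * (dv b x \<bullet> v x))"
        by (simp add: sum.distrib sum_distrib_left)
      finally show ?thesis
        by (simp add: sq_def[symmetric] euler_def inner_sum_left)
    qed
    moreover have "4 * t / (sq x)\<^sup>2 * (v x \<bullet> v x) * sq x = 4 * t / sq x * (v x \<bullet> v x)"
      by (simp add: power2_eq_square)
    ultimately show ?thesis by (simp add: G_def)
  qed
  have IG: "integral\<^sup>L lborel G = 0"
    using integral_euler[OF f Cf] unfolding G .
  have CG: "Cc G"
    unfolding G[abs_def, symmetric]
    by (intro Cc_add Cc_sum Cc_mult_right Cf Cc_derivative[OF f Cf] continuous_intros)
  define A where "A x = 2 * angular dv x (euler dv x) + n * angular dv x (v x)" for x
  have CA: "Cc A"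
    unfolding A_def[abs_def] by (intro Cc_add Cc_mult_right continuous_intros Cc_angular[OF v Cv] Cc_euler[OF v Cv] Cv)
  have IA: "integral\<^sup>L lborel A = 0"
    unfolding A_def[abs_def] by (rule integral_angular[OF v Cv])
  have cts: "continuous_on ?P (\<lambda>x. exp (t / sq x))" "continuous_on ?P (\<lambda>x. 4 * t / sq x)"
    by (auto intro!: continuous_intros continuous_sq)
  have Cl: "Cc (\<lambda>x. ((4 * t / sq x - n\<^sup>2 / 4) * (exp (t / sq x))\<^sup>2) * (u x \<bullet> u x))"
    by (rule Cc_mult_vanishing[OF _ Cc_bilinear_left[OF bounded_bilinear_inner u(2) C1_alongD(1)[OF u(1)]] \<delta>(1)])
       (auto intro!: continuous_intros continuous_sq simp: \<delta>(2))
  have Cr: "Cc (\<lambda>x. (sq x * (exp (t / sq x))\<^sup>2) * (D du x \<bullet> D du x))"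
    by (rule Cc_mult_vanishing[OF _ Cc_bilinear_left[OF bounded_bilinear_inner Cc_euler(2)[OF u] continuous_D[OF u(1)]] \<delta>(1)])
       (auto intro!: continuous_intros continuous_sq simp: Du0)
  have pointwise: "A x - G x + ((4 * t / sq x - n\<^sup>2 / 4) * (exp (t / sq x))\<^sup>2) * (u x \<bullet> u x)
      \<le> (sq x * (exp (t / sq x))\<^sup>2) * (D du x \<bullet> D du x)" for x
  proof (cases "sq x = 0")
    case True
    then have "v x = 0" "dv b x = 0" if "b \<in> B" for b
      using \<delta> du0 that by (auto simp: v_def dv_def)
    moreover have "u x = 0" using True \<delta> by simp
    moreover have "v x = 0" using True \<delta> by (simp add: v_def)
    ultimately show ?thesis
      using True by (simp add: A_def G_def angular_def euler_def D_def L.zero_right)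
  next
    case False
    define \<mu> where "\<mu> = - (2 * t / (sq x)\<^sup>2)"
    have m: "\<mu> * sq x = m x"
      using False by (simp add: \<mu>_def m_def power2_eq_square)
    have "D dv x = (\<mu> * exp (t / sq x)) *\<^sub>R (\<Sum>b\<in>B. (x \<bullet> b) *\<^sub>R L b (u x)) + exp (t / sq x) *\<^sub>R D du x"
      by (simp add: D_def dv_def \<mu>_def L.add_right L.diff_right L.scaleR_right sum.distrib sum_subtractf sum_negf scaleR_sum_right mult_ac)
    also have "(\<Sum>b\<in>B. (x \<bullet> b) *\<^sub>R L b (u x)) = L (proj x) (u x)"
      by (simp add: proj_def L.sum_left L.scaleR_left)
    finally have "D dv x - \<mu> *\<^sub>R L (proj x) (v x) = exp (t / sq x) *\<^sub>R D du x"
      by (simp add: v_def L.scaleR_right)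
    then have "sq x * (norm (D dv x - \<mu> *\<^sub>R L (proj x) (v x)))\<^sup>2 = (sq x * (exp (t / sq x))\<^sup>2) * (D du x \<bullet> D du x)"
      by (simp add: power_mult_distrib power2_norm_eq_inner)
    moreover have "v x \<bullet> v x = (exp (t / sq x))\<^sup>2 * (u x \<bullet> u x)"
      by (simp add: v_def power2_eq_square)
    ultimately show ?thesis
      using pointwise_estimate[of dv x v \<mu>] False unfolding m A_def G_def
      by (simp add: algebra_simps)
  qed
  have "?l = integral\<^sup>L lborel (\<lambda>x. A x - G x + ((4 * t / sq x - n\<^sup>2 / 4) * (exp (t / sq x))\<^sup>2) * (u x \<bullet> u x))"
    using Cc_integrable[OF CA] Cc_integrable[OF CG] Cc_integrable[OF Cl] IA IG by simp
  also have "\<dots> \<le> ?r"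
    using pointwise Cc_integrable[OF Cc_add[OF Cc_diff[OF CA CG] Cl]] Cc_integrable[OF Cr]
    by (intro integral_mono) auto
  finally show ?thesis .
qed

section \<open>Unique continuation\<close>

lemma proj_add: "proj (x + y) = proj x + proj y"
  by (simp add: proj_def inner_add_left scaleR_add_left sum.distrib)

lemma proj_scaleR: "proj (c *\<^sub>R x) = c *\<^sub>R proj x"
  by (simp add: proj_def scaleR_sum_right)

lemma proj_diff: "proj (x - y) = proj x - proj y"
  by (simp add: proj_def inner_diff_left scaleR_diff_left sum_subtractf)

lemma proj_basis: "b \<in> B \<Longrightarrow> proj b = b"
proof -
  assume b: "b \<in> B"
  have "proj b = (\<Sum>c\<in>B. if b = c then c else 0)"
    unfolding proj_def by (rule sum.cong) (simp_all add: orthonormal[OF b])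
  then show ?thesis using b finite_B by simp
qed

lemma proj_in_span: "proj x \<in> span B"
  unfolding proj_def by (intro span_sum span_scale span_base)

lemma proj_span: "x \<in> span B \<Longrightarrow> proj x = x"
  by (induction rule: span_induct_alt) (simp_all add: proj_add proj_scaleR proj_basis, simp add: proj_def)

text \<open>A cutoff in the directions orthogonal to the slice space; \<open>D\<close> does not see it.\<close>

lemma C1_cutoff_complement:
  "C1_along B S (\<lambda>x. max 0 (c - norm (x - proj x))) (\<lambda>b x. 0)"
proof (rule C1_alongI)
  show "continuous_on S (\<lambda>x. max 0 (c - norm (x - proj x)))"
    by (intro continuous_intros continuous_proj)
  show "((\<lambda>t. max 0 (c - norm (x + t *\<^sub>R b - proj (x + t *\<^sub>R b)))) has_vector_derivative 0) (at 0)"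
    if "b \<in> B" for b x
    using that by (simp add: proj_add proj_scaleR proj_basis)
qed simp

text \<open>Let \<open>sq x0 < a < b < R\<close> and apply \<open>carleman\<close> to \<open>\<chi> h\<close> with a cutoff \<open>\<chi>\<close> that is \<open>1\<close> for \<open>\<rho> \<le> a\<close> and
  \<open>0\<close> for \<open>\<rho> \<ge> b\<close>.  Then \<open>D (\<chi> h)\<close> is supported in \<open>a \<le> \<rho> \<le> b\<close>, where the weight is at most
  \<open>exp (2 t / a)\<close>, while for \<open>\<rho> < a\<close> it is at least that.  Dividing by \<open>exp (2 t / a)\<close> bounds \<open>t\<close> times the
  integral of \<open>|\<chi> h|\<^sup>2\<close> over \<open>\<rho> < a\<close> independently of \<open>t\<close>, so this integral is zero.\<close>

lemma unique_continuation_centred: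
  assumes h: "C1_along B {x. sq x < R} h dh" and Dh: "\<And>x. sq x < R \<Longrightarrow> D dh x = 0"
    and \<delta>: "0 < \<delta>" "\<And>x. sq x < \<delta> \<Longrightarrow> h x = 0" and x0: "sq x0 < R"
  shows "h x0 = 0"
proof -
  obtain a where a: "sq x0 < a" "a < R" using x0 dense by blast
  obtain b where b: "a < b" "b < R" using a dense by blast
  have a0: "0 < a" using sq_nonneg[of x0] a by linarith
  obtain F F' where F: "\<And>s. (F has_real_derivative F' s) (at s)" "continuous_on UNIV F'"
    "\<And>s. s \<le> a \<Longrightarrow> F s = 1 \<and> F' s = 0" "\<And>s. b \<le> s \<Longrightarrow> F s = 0 \<and> F' s = 0"
    using smooth_cutoff_exists[OF b(1)] by blast
  define c where "c = 1 + norm (x0 - proj x0)"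
  define \<kappa> where "\<kappa> x = max 0 (c - norm (x - proj x))" for x
  define w where "w x = F (sq x) * \<kappa> x" for x
  define dw where "dw k x = F' (sq x) * (2 * (x \<bullet> k)) * \<kappa> x" for k x
  \<comment> \<open>\<open>w\<close> and \<open>dw\<close> vanish for \<open>sq x \<ge> b\<close>, so \<open>u\<close> is \<open>C\<^sup>1\<close> whatever the values of \<open>h\<close> there\<close>
  define u where "u x = w x *\<^sub>R h x" for x
  define du where "du k x = dw k x *\<^sub>R h x + w x *\<^sub>R dh k x" for k x
  have w: "C1_along B UNIV w dw"
  proof -
    have "C1_along B UNIV (\<lambda>x. F (sq x)) (\<lambda>k x. F' (sq x) * (2 * (x \<bullet> k)))"
      by (rule C1_along_real_compose[OF C1_sq, where T = UNIV]) (auto intro: F)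
    from C1_along_bilinear[OF bounded_bilinear_mult this C1_cutoff_complement[of _ c]]
    show ?thesis
      by (simp add: w_def[abs_def] dw_def[abs_def] \<kappa>_def)
  qed
  have "C1_along B {x. b < sq x} u du"
    using F(4) by (intro C1_along_cong[OF C1_along_const[of _ _ 0] open_sq(1)])
      (auto simp: u_def du_def w_def dw_def)
  moreover have "C1_along B {x. sq x < R} u du"
    unfolding u_def[abs_def] du_def[abs_def]
    by (rule C1_along_scaleR[OF C1_along_subset[OF w] h]) simp
  ultimately have "C1_along B ({x. sq x < R} \<union> {x. b < sq x}) u du"
    by (intro C1_along_Un open_sq)
  moreover have "{x. sq x < R} \<union> {x. b < sq x} = UNIV"
    using b by auto
  ultimately have u: "C1_along B UNIV u du" by simp
  have support: "u x = 0" if "sqrt b + c < norm x" for x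
  proof -
    have "norm x \<le> norm (proj x) + norm (x - proj x)"
      using norm_triangle_ineq[of "proj x" "x - proj x"] by simp
    then have "sqrt b < sqrt (sq x) \<or> c < norm (x - proj x)"
      using that unfolding norm_proj by linarith
    then have "b \<le> sq x \<or> \<kappa> x = 0"
      by (auto simp: \<kappa>_def)
    then show ?thesis using F(4) by (auto simp: u_def w_def)
  qed
  then have Cu: "Cc u"
    using C1_alongD(1)[OF u] unfolding Cc_def by blast
  have u0: "u x = 0" if "sq x < \<delta>" for x
    using \<delta>(2)[OF that] by (simp add: u_def)
  have Du0: "D du x = 0" if "sq x < a" for x
  proof -
    have "D du x = w x *\<^sub>R D dh x"
      using F(3)[of "sq x"] that by (simp add: D_def du_def dw_def L.scaleR_right scaleR_sum_right)
    then show ?thesis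
      using Dh[of x] that a by simp
  qed
  define K where "K = integral\<^sup>L lborel (\<lambda>x. sq x * (D du x \<bullet> D du x))"
  \<comment> \<open>a continuous substitute for the indicator function of \<open>{x. sq x < a}\<close>\<close>
  define \<zeta> where "\<zeta> x = max 0 (min 1 (a - sq x))" for x
  define I where "I = integral\<^sup>L lborel (\<lambda>x. \<zeta> x * (u x \<bullet> u x))"
  have CK: "Cc (\<lambda>x. sq x * (D du x \<bullet> D du x))"
    by (intro Cc_mult_right continuous_sq Cc_bilinear_left[OF bounded_bilinear_inner Cc_euler(2)[OF u Cu] continuous_D[OF u]])
  have CI: "Cc (\<lambda>x. \<zeta> x * (u x \<bullet> u x))"
    unfolding \<zeta>_def
    by (intro Cc_mult_right Cc_bilinear_left[OF bounded_bilinear_inner Cu C1_alongD(1)[OF u]] continuous_intros continuous_sq)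
  have bound: "(2 * t / b) * I \<le> K" if t: "0 \<le> t" "n\<^sup>2 / 4 \<le> 2 * t / b" for t
  proof -
    let ?E = "(exp (t / a))\<^sup>2"
    have "?E * ((2 * t / b) * I) = integral\<^sup>L lborel (\<lambda>x. (?E * (2 * t / b)) * (\<zeta> x * (u x \<bullet> u x)))"
      by (simp add: I_def)
    also have "\<dots> \<le> integral\<^sup>L lborel (\<lambda>x. ((4 * t / sq x - n\<^sup>2 / 4) * (exp (t / sq x))\<^sup>2) * (u x \<bullet> u x))"
    proof (rule integral_mono)
      fix x
      show "(?E * (2 * t / b)) * (\<zeta> x * (u x \<bullet> u x))
         \<le> ((4 * t / sq x - n\<^sup>2 / 4) * (exp (t / sq x))\<^sup>2) * (u x \<bullet> u x)"
      proof (cases "u x = 0")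
        case False
        then have *: "\<delta> \<le> sq x" "sq x < b"
          using u0 F(4)[of "sq x"] by (force simp: u_def w_def)+
        then have "4 * t / b \<le> 4 * t / sq x"
          using t \<delta>(1) by (intro divide_left_mono mult_pos_pos) auto
        then have **: "2 * t / b \<le> 4 * t / sq x - n\<^sup>2 / 4"
          using t(2) by simp
        have "?E * (2 * t / b) * \<zeta> x \<le> (4 * t / sq x - n\<^sup>2 / 4) * (exp (t / sq x))\<^sup>2"
        proof (cases "sq x < a")
          case True
          then have "?E \<le> (exp (t / sq x))\<^sup>2"
            using t \<delta>(1) * by (intro power_mono) (auto intro!: divide_left_mono)
          then have "?E * (2 * t / b) \<le> (exp (t / sq x))\<^sup>2 * (4 * t / sq x - n\<^sup>2 / 4)"
            using ** t \<delta>(1) * by (intro mult_mono) auto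
          moreover have "?E * (2 * t / b) * \<zeta> x \<le> ?E * (2 * t / b) * 1"
            using t \<delta>(1) * by (intro mult_left_mono) (auto simp: \<zeta>_def)
          ultimately show ?thesis by (simp add: mult.commute)
        next
          case False
          then have "\<zeta> x = 0" by (simp add: \<zeta>_def)
          moreover have "0 \<le> 2 * t / b" using t \<delta>(1) * by auto
          ultimately show ?thesis using ** by simp
        qed
        from mult_right_mono[OF this inner_ge_zero[of "u x"]] show ?thesis
          by (simp only: mult.assoc)
      qed simp
    next
      show "integrable lborel (\<lambda>x. (?E * (2 * t / b)) * (\<zeta> x * (u x \<bullet> u x)))"
        by (intro Cc_integrable Cc_mult_right CI continuous_intros)
      show "integrable lborel (\<lambda>x. ((4 * t / sq x - n\<^sup>2 / 4) * (exp (t / sq x))\<^sup>2) * (u x \<bullet> u x))"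
        by (intro Cc_integrable Cc_mult_vanishing[OF _ Cc_bilinear_left[OF bounded_bilinear_inner Cu C1_alongD(1)[OF u]] \<delta>(1)])
          (auto intro!: continuous_intros continuous_sq simp: u0)
    qed
    also have "\<dots> \<le> integral\<^sup>L lborel (\<lambda>x. (sq x * (exp (t / sq x))\<^sup>2) * (D du x \<bullet> D du x))"
      by (rule carleman[OF u Cu \<delta>(1) u0])
    also have "\<dots> \<le> integral\<^sup>L lborel (\<lambda>x. ?E * (sq x * (D du x \<bullet> D du x)))"
    proof (rule integral_mono)
      show "integrable lborel (\<lambda>x. (sq x * (exp (t / sq x))\<^sup>2) * (D du x \<bullet> D du x))"
        by (rule Cc_integrable, rule Cc_mult_vanishing[OF _ Cc_bilinear_left[OF bounded_bilinear_inner Cc_euler(2)[OF u Cu] continuous_D[OF u]] a0])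
           (auto intro!: continuous_intros continuous_sq simp: Du0)
      show "integrable lborel (\<lambda>x. ?E * (sq x * (D du x \<bullet> D du x)))"
        by (intro Cc_integrable Cc_mult_right[OF _ CK] continuous_intros)
      fix x
      show "(sq x * (exp (t / sq x))\<^sup>2) * (D du x \<bullet> D du x) \<le> ?E * (sq x * (D du x \<bullet> D du x))"
      proof (cases "sq x < a")
        case False
        then have "(exp (t / sq x))\<^sup>2 \<le> ?E"
          using t a0 by (intro power_mono) (auto intro!: divide_left_mono)
        then have "(exp (t / sq x))\<^sup>2 * (sq x * (D du x \<bullet> D du x)) \<le> ?E * (sq x * (D du x \<bullet> D du x))"
          by (intro mult_right_mono mult_nonneg_nonneg sq_nonneg inner_ge_zero)
        then show ?thesis by (simp add: mult_ac)
      qed (simp add: Du0)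
    qed
    also have "\<dots> = ?E * K" by (simp add: K_def)
    finally show ?thesis
      by (rule mult_left_le_imp_le) simp
  qed
  have "I \<le> 0"
  proof (rule ccontr)
    assume "\<not> I \<le> 0"
    then have I: "0 < I" by simp
    have b0: "0 < b" using a0 b by linarith
      \<comment> \<open>\<open>s\<close> is the value of \<open>2 t / b\<close>: admissible in \<open>bound\<close>, and so large that \<open>s * I > K\<close>\<close>
  define s where "s = n\<^sup>2 / 4 + \<bar>K\<bar> / I + 1"
    have s: "0 \<le> s" "n\<^sup>2 / 4 \<le> s" using I by (auto simp: s_def add_nonneg_nonneg)
    have "s * I \<le> K"
      using bound[of "s * b / 2"] s b0 by simp
    moreover have "s * I = n\<^sup>2 / 4 * I + \<bar>K\<bar> + I"
      using I by (simp add: s_def distrib_right)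
    moreover have "0 \<le> n\<^sup>2 / 4 * I" using I by simp
    ultimately show False using I by linarith
  qed
  then have "\<zeta> x0 * (u x0 \<bullet> u x0) = 0"
    unfolding I_def by (intro Cc_eq_zero_if_integral_nonpos[OF CI]) (auto simp: \<zeta>_def)
  moreover have "\<zeta> x0 > 0" using a by (simp add: \<zeta>_def)
  moreover have "w x0 > 0" using F(3)[of "sq x0"] a by (simp add: w_def \<kappa>_def c_def)
  ultimately show ?thesis by (simp add: u_def)
qed

lemma unique_continuation:
  assumes z: "z \<in> span B" and u: "C1_along B {x. norm (proj x - z) < R} u du"
    and Du: "\<And>x. norm (proj x - z) < R \<Longrightarrow> D du x = 0"
    and \<epsilon>: "0 < \<epsilon>" "\<And>x. norm (proj x - z) < \<epsilon> \<Longrightarrow> u x = 0" and x: "norm (proj x - z) < R"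
  shows "u x = 0"
proof -
  have R: "0 < R" using x norm_ge_zero[of "proj x - z"] by linarith
  have *: "norm (proj (y + z) - z) < r \<longleftrightarrow> sq y < r\<^sup>2" if "0 < r" for y r
  proof -
    have "norm (proj (y + z) - z) = sqrt (sq y)"
      by (simp add: proj_add proj_span[OF z] norm_proj)
    then show ?thesis
      using that real_less_rsqrt real_sqrt_less_iff[of "sq y" "r\<^sup>2"] by simp
  qed
  have "u ((x - z) + z) = 0"
  proof (rule unique_continuation_centred[of "R\<^sup>2" "\<lambda>y. u (y + z)" "\<lambda>b y. du b (y + z)" "\<epsilon>\<^sup>2"])
    show "C1_along B {x. sq x < R\<^sup>2} (\<lambda>y. u (y + z)) (\<lambda>b y. du b (y + z))"
      using C1_along_translate[OF u, of z] *[OF R] by simp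
    show "D (\<lambda>b y. du b (y + z)) y = 0" if "sq y < R\<^sup>2" for y
      using Du[of "y + z"] that *[OF R] by (simp add: D_def)
    show "u (y + z) = 0" if "sq y < \<epsilon>\<^sup>2" for y
      using \<epsilon>(2) that *[OF \<epsilon>(1)] by simp
    show "sq (x - z) < R\<^sup>2" "0 < \<epsilon>\<^sup>2"
      using *[OF R, of "x - z"] x \<epsilon>(1) by auto
  qed
  then show ?thesis by simp
qed

section \<open>The identity theorem on slices\<close>

text \<open>For relatively open \<open>S\<close> the continuity of \<open>h\<close> is a consequence, see \<open>C1_along_cylinder\<close>.\<close>

definition monogenic_on :: "'a set \<Rightarrow> ('a \<Rightarrow> 'b) \<Rightarrow> ('a \<Rightarrow> 'a \<Rightarrow> 'b) \<Rightarrow> bool" where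
  "monogenic_on S h dh \<longleftrightarrow>
     (\<forall>b\<in>B. continuous_on S (dh b) \<and>
       (\<forall>x\<in>S. ((\<lambda>t. h (x + t *\<^sub>R b)) has_vector_derivative dh b x) (at 0))) \<and>
     (\<forall>x\<in>S. D dh x = 0)"

lemma monogenic_onD:
  assumes "monogenic_on S h dh"
  shows "b \<in> B \<Longrightarrow> continuous_on S (dh b)"
    "b \<in> B \<Longrightarrow> x \<in> S \<Longrightarrow> ((\<lambda>t. h (x + t *\<^sub>R b)) has_vector_derivative dh b x) (at 0)"
    "x \<in> S \<Longrightarrow> D dh x = 0"
  using assms by (auto simp: monogenic_on_def)

lemma norm_basis: "b \<in> B \<Longrightarrow> norm b = 1"
  by (simp add: norm_eq_sqrt_inner orthonormal)

lemma slice_ball: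
  assumes "openin (top_of_set (span B)) S" "p \<in> S"
  obtains r where "0 < r" "\<And>x. x \<in> span B \<Longrightarrow> norm (x - p) < r \<Longrightarrow> x \<in> S"
proof -
  from assms(1)[unfolded openin_contains_ball, THEN conjunct2, rule_format, OF assms(2)]
  obtain e where e: "0 < e" "ball p e \<inter> span B \<subseteq> S" by blast
  have "x \<in> S" if "x \<in> span B" "norm (x - p) < e" for x
    using that e(2) by (auto simp: dist_norm norm_minus_commute)
  then show ?thesis using that e(1) by blast
qed

text \<open>One step of the path from \<open>p\<close> to \<open>p + y\<close> parallel to the basis vectors: the mean value inequality
  on the segment in direction \<open>c\<close>, with the derivative controlled by its continuity at \<open>p\<close>.\<close>

lemma partial_increment_has_derivative:
  assumes S: "openin (top_of_set (span B)) S" and h: "monogenic_on S h dh" and p: "p \<in> S"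
    and T: "T \<subseteq> B" and c: "c \<in> B"
  shows "((\<lambda>y. h (p + (\<Sum>b\<in>T. (y \<bullet> b) *\<^sub>R b) + (y \<bullet> c) *\<^sub>R c) - h (p + (\<Sum>b\<in>T. (y \<bullet> b) *\<^sub>R b)))
    has_derivative (\<lambda>y. (y \<bullet> c) *\<^sub>R dh c p)) (at 0)"
  unfolding has_derivative_at_alt
proof (intro conjI allI impI)
  show "bounded_linear (\<lambda>y. (y \<bullet> c) *\<^sub>R dh c p)"
    by (intro bounded_linear_intros)
  fix e :: real assume e: "0 < e"
  have p_span: "p \<in> span B"
    using S p openin_imp_subset by blast
  obtain r where r: "0 < r" "\<And>x. x \<in> span B \<Longrightarrow> norm (x - p) < r \<Longrightarrow> x \<in> S"
    using slice_ball[OF S p] by blast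
  obtain d where d: "0 < d" "\<And>x. x \<in> S \<Longrightarrow> norm (x - p) < d \<Longrightarrow> norm (dh c x - dh c p) < e"
    using monogenic_onD(1)[OF h c, unfolded continuous_on_iff dist_norm, rule_format, OF p e] by blast
  \<comment> \<open>\<open>n + 1\<close> bounds the length of the path relative to \<open>norm y\<close>\<close>
  define k where "k = min r d / (n + 1)"
  have k: "0 < k" using r d by (simp add: k_def)
  have bound: "norm ((p + (\<Sum>b\<in>T. (y \<bullet> b) *\<^sub>R b) + s *\<^sub>R c) - p) < min r d"
    if "norm y < k" "\<bar>s\<bar> \<le> \<bar>y \<bullet> c\<bar>" for y s
  proof -
    have y: "\<bar>y \<bullet> b\<bar> \<le> norm y" if "b \<in> B" for b
      using Cauchy_Schwarz_ineq2[of y b] norm_basis[OF that] by simp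
    have "norm (\<Sum>b\<in>T. (y \<bullet> b) *\<^sub>R b) \<le> (\<Sum>b\<in>T. norm y)"
      using T y norm_basis by (intro sum_norm_le) (auto simp: subset_eq)
    also have "\<dots> \<le> n * norm y"
      using card_mono[OF finite_B T] by (simp add: mult_right_mono)
    finally have "norm (\<Sum>b\<in>T. (y \<bullet> b) *\<^sub>R b) \<le> n * norm y" .
    moreover have "norm (s *\<^sub>R c) \<le> norm y"
      using that(2) y[OF c] norm_basis[OF c] by simp
    ultimately have "norm ((\<Sum>b\<in>T. (y \<bullet> b) *\<^sub>R b) + s *\<^sub>R c) \<le> (n + 1) * norm y"
      using norm_triangle_ineq[of "\<Sum>b\<in>T. (y \<bullet> b) *\<^sub>R b" "s *\<^sub>R c"] by (simp add: distrib_right)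
    also have "\<dots> < (n + 1) * k"
      using that(1) by (intro mult_strict_left_mono) (auto intro: add_nonneg_pos)
    also have "\<dots> = min r d"
      by (simp add: k_def add_nonneg_eq_0_iff)
    finally show ?thesis by (simp add: add.assoc)
  qed
  have "norm (h (p + (\<Sum>b\<in>T. (y \<bullet> b) *\<^sub>R b) + (y \<bullet> c) *\<^sub>R c) - h (p + (\<Sum>b\<in>T. (y \<bullet> b) *\<^sub>R b))
      - (y \<bullet> c) *\<^sub>R dh c p) \<le> e * norm y" if y: "norm y < k" for y
  proof -
    define q where "q = p + (\<Sum>b\<in>T. (y \<bullet> b) *\<^sub>R b)"
    define I where "I = {- \<bar>y \<bullet> c\<bar>..\<bar>y \<bullet> c\<bar>}"
    have q: "q + s *\<^sub>R c \<in> S \<and> norm (dh c (q + s *\<^sub>R c) - dh c p) < e" if "s \<in> I" for s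
    proof -
      have "q + s *\<^sub>R c \<in> span B"
        unfolding q_def using p_span T c by (intro span_add span_sum span_scale) (auto intro: span_base)
      moreover have "norm (q + s *\<^sub>R c - p) < min r d"
        using bound[OF y, of s] that by (auto simp: I_def q_def)
      ultimately show ?thesis using r(2) d(2) by simp
    qed
    have deriv: "((\<lambda>s. h (q + s *\<^sub>R c) - s *\<^sub>R dh c p) has_derivative (\<lambda>t. t *\<^sub>R (dh c (q + s *\<^sub>R c) - dh c p)))
       (at s within I)" if "s \<in> I" for s
    proof -
      have "((\<lambda>t. h ((q + s *\<^sub>R c) + t *\<^sub>R c)) has_vector_derivative dh c (q + s *\<^sub>R c)) (at (s - s))"
        using monogenic_onD(2)[OF h c] q[OF that] by simp
      from has_vector_derivative_at_within[OF this]
      have *: "((\<lambda>t. h ((q + s *\<^sub>R c) + t *\<^sub>R c)) has_vector_derivative dh c (q + s *\<^sub>R c))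
          (at (s - s) within (\<lambda>t. t - s) ` I)" .
      have "((\<lambda>t. h (q + s *\<^sub>R c + (t - s) *\<^sub>R c)) has_vector_derivative dh c (q + s *\<^sub>R c)) (at s within I)"
        using vector_diff_chain_within[of "\<lambda>t. t - s" 1 s I, OF has_vector_derivative_diff[OF has_vector_derivative_id has_vector_derivative_const, simplified] *]
        by (simp add: o_def)
      then have "((\<lambda>t. h (q + t *\<^sub>R c)) has_vector_derivative dh c (q + s *\<^sub>R c)) (at s within I)"
        by (simp add: algebra_simps)
      then have "((\<lambda>t. h (q + t *\<^sub>R c) - t *\<^sub>R dh c p) has_vector_derivative dh c (q + s *\<^sub>R c) - dh c p) (at s within I)"
        by (auto intro!: derivative_eq_intros)
      then show ?thesis by (simp add: has_vector_derivative_def)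
    qed
    have "norm ((h (q + (y \<bullet> c) *\<^sub>R c) - (y \<bullet> c) *\<^sub>R dh c p) - (h (q + 0 *\<^sub>R c) - 0 *\<^sub>R dh c p)) \<le> e * norm (y \<bullet> c - 0)"
    proof (rule differentiable_bound[OF _ deriv])
      show "onorm (\<lambda>t. t *\<^sub>R (dh c (q + s *\<^sub>R c) - dh c p)) \<le> e" if "s \<in> I" for s
        using q[OF that] by (intro onorm_le) (simp add: mult.commute[of e] mult_left_mono)
    qed (auto simp: I_def)
    also have "\<dots> \<le> e * norm y"
      using Cauchy_Schwarz_ineq2[of y c] norm_basis[OF c] e by (intro mult_left_mono) auto
    finally show ?thesis by (simp add: q_def algebra_simps)
  qed
  then show "\<exists>d>0. \<forall>y. norm (y - 0) < d \<longrightarrow>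
      norm (h (p + (\<Sum>b\<in>T. (y \<bullet> b) *\<^sub>R b) + (y \<bullet> c) *\<^sub>R c) - h (p + (\<Sum>b\<in>T. (y \<bullet> b) *\<^sub>R b)) -
        (h (p + (\<Sum>b\<in>T. (0 \<bullet> b) *\<^sub>R b) + (0 \<bullet> c) *\<^sub>R c) - h (p + (\<Sum>b\<in>T. (0 \<bullet> b) *\<^sub>R b))) -
        ((y - 0) \<bullet> c) *\<^sub>R dh c p) \<le> e * norm (y - 0)"
    using k by (intro exI[of _ k]) simp
qed

lemma frechet_derivative_on_slice:
  assumes S: "openin (top_of_set (span B)) S" and h: "monogenic_on S h dh" and x: "proj x \<in> S"
  shows "((\<lambda>y. h (proj y)) has_derivative (\<lambda>v. \<Sum>b\<in>B. (v \<bullet> b) *\<^sub>R dh b (proj x))) (at x)"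
proof -
  have "((\<lambda>y. h (proj x + (\<Sum>b\<in>T. (y \<bullet> b) *\<^sub>R b))) has_derivative
      (\<lambda>y. \<Sum>b\<in>T. (y \<bullet> b) *\<^sub>R dh b (proj x))) (at 0)" if "T \<subseteq> B" for T
    using finite_subset[OF that finite_B] that
  proof (induction T rule: finite_induct)
    case empty
    show ?case by simp
  next
    case (insert c T)
    have "((\<lambda>y. (h (proj x + (\<Sum>b\<in>T. (y \<bullet> b) *\<^sub>R b) + (y \<bullet> c) *\<^sub>R c) - h (proj x + (\<Sum>b\<in>T. (y \<bullet> b) *\<^sub>R b)))
         + h (proj x + (\<Sum>b\<in>T. (y \<bullet> b) *\<^sub>R b)))
       has_derivative (\<lambda>y. (y \<bullet> c) *\<^sub>R dh c (proj x) + (\<Sum>b\<in>T. (y \<bullet> b) *\<^sub>R dh b (proj x)))) (at 0)"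
      using insert by (intro has_derivative_add partial_increment_has_derivative[OF S h x]) auto
    then show ?case
      using insert(1,2) by (simp add: add_ac)
  qed
  from this[OF order_refl]
  have "((\<lambda>y. h (proj x + proj y)) has_derivative (\<lambda>y. \<Sum>b\<in>B. (y \<bullet> b) *\<^sub>R dh b (proj x))) (at (x - x))"
    by (simp add: proj_def)
  from has_derivative_compose[OF has_derivative_diff[OF has_derivative_ident has_derivative_const[of x]] this]
  show ?thesis by (simp add: proj_diff)
qed

lemma C1_along_cylinder:
  assumes S: "openin (top_of_set (span B)) S" and h: "monogenic_on S h dh"
  shows "C1_along B {x. proj x \<in> S} (\<lambda>x. h (proj x)) (\<lambda>b x. dh b (proj x))"
proof (rule C1_alongI)
  show "continuous_on {x. proj x \<in> S} (\<lambda>x. h (proj x))"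
    using has_derivative_continuous[OF frechet_derivative_on_slice[OF S h]]
    by (intro continuous_at_imp_continuous_on) auto
  show "continuous_on {x. proj x \<in> S} (\<lambda>x. dh b (proj x))" if "b \<in> B" for b
    by (rule continuous_on_compose2[OF monogenic_onD(1)[OF h that] continuous_proj]) auto
  show "((\<lambda>t. h (proj (x + t *\<^sub>R b))) has_vector_derivative dh b (proj x)) (at 0)"
    if "b \<in> B" "x \<in> {x. proj x \<in> S}" for b x
    using monogenic_onD(2)[OF h that(1), of "proj x"] that by (simp add: proj_add proj_scaleR proj_basis)
qed

lemma unique_continuation_slice:
  assumes S: "openin (top_of_set (span B)) S" and h: "monogenic_on S h dh" and z: "z \<in> span B"
    and R: "\<And>x. x \<in> span B \<Longrightarrow> norm (x - z) < R \<Longrightarrow> x \<in> S"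
    and \<epsilon>: "0 < \<epsilon>" "\<And>x. x \<in> span B \<Longrightarrow> norm (x - z) < \<epsilon> \<Longrightarrow> h x = 0"
    and x: "x \<in> span B" "norm (x - z) < R"
  shows "h x = 0"
proof -
  have "h (proj x) = 0"
  proof (rule unique_continuation[OF z, of R "\<lambda>x. h (proj x)" "\<lambda>b x. dh b (proj x)" \<epsilon>])
    show "C1_along B {x. norm (proj x - z) < R} (\<lambda>x. h (proj x)) (\<lambda>b x. dh b (proj x))"
      using R proj_in_span by (intro C1_along_subset[OF C1_along_cylinder[OF S h]]) auto
    show "D (\<lambda>b x. dh b (proj x)) x = 0" if "norm (proj x - z) < R" for x
      using monogenic_onD(3)[OF h R[OF proj_in_span that]] by (simp add: D_def)
  qed (use \<epsilon> x proj_in_span proj_span in auto)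
  then show ?thesis by (simp add: proj_span x)
qed

text \<open>Let \<open>Z\<close> be the interior of the zero set relative to the slice space.  If a point of \<open>Z\<close> is close
  to \<open>x\<close> compared with the distance from \<open>x\<close> to the boundary of \<open>S\<close>, then a ball around that point
  contains a neighbourhood of \<open>x\<close>, and unique continuation on the ball gives \<open>x \<in> Z\<close>.  So \<open>Z\<close> is both
  open and closed in \<open>S\<close>.\<close>

lemma identity_theorem_slice:
  assumes S: "openin (top_of_set (span B)) S" "connected S" and h: "monogenic_on S h dh"
    and y: "y \<in> S" and \<epsilon>: "0 < \<epsilon>" "\<And>x. x \<in> span B \<Longrightarrow> norm (x - y) < \<epsilon> \<Longrightarrow> h x = 0"
    and x: "x \<in> S"
  shows "h x = 0"
proof -
  define Z where "Z = {x \<in> S. \<exists>\<epsilon>>0. \<forall>w\<in>span B. norm (w - x) < \<epsilon> \<longrightarrow> h w = 0}"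
  have sub: "S \<subseteq> span B" using S(1) openin_imp_subset by blast
  have local_dichotomy: "\<exists>e>0. \<forall>w\<in>S. norm (w - x) < e \<longrightarrow> (w \<in> Z \<longleftrightarrow> x \<in> Z)" if x: "x \<in> S" for x
  proof -
    obtain r where r: "0 < r" "\<And>w. w \<in> span B \<Longrightarrow> norm (w - x) < r \<Longrightarrow> w \<in> S"
      using slice_ball[OF S(1) x] by blast
    have spread: "\<forall>v\<in>span B. norm (v - x) < r / 2 \<longrightarrow> h v = 0" if w: "w \<in> Z" "norm (w - x) < r / 4" for w
    proof (intro ballI impI)
      fix v assume v: "v \<in> span B" "norm (v - x) < r / 2"
      obtain e where e: "0 < e" "\<And>u. u \<in> span B \<Longrightarrow> norm (u - w) < e \<Longrightarrow> h u = 0"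
        using w(1) by (auto simp: Z_def)
      have wS: "w \<in> span B" using w sub by (auto simp: Z_def)
      show "h v = 0"
      proof (rule unique_continuation_slice[OF S(1) h wS, of "3 * r / 4" e])
        show "u \<in> S" if "u \<in> span B" "norm (u - w) < 3 * r / 4" for u
          using r(2)[OF that(1)] that(2) w(2) norm_triangle_ineq[of "u - w" "w - x"] by simp
        show "norm (v - w) < 3 * r / 4"
          using v(2) w(2) norm_triangle_ineq[of "v - x" "x - w"] by (simp add: norm_minus_commute[of x w])
      qed (use e v in auto)
    qed
    have "w \<in> Z \<longleftrightarrow> x \<in> Z" if w: "w \<in> S" "norm (w - x) < r / 4" for w
    proof
      assume "w \<in> Z"
      from spread[OF this w(2)] show "x \<in> Z"
        using r(1) x by (auto simp: Z_def intro!: exI[of _ "r / 2"])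
    next
      assume "x \<in> Z"
      have "h v = 0" if "v \<in> span B" "norm (v - w) < r / 4" for v
        using spread[OF \<open>x \<in> Z\<close>] r(1) that w(2) norm_triangle_ineq[of "v - w" "w - x"] by simp
      then show "w \<in> Z"
        using r(1) w(1) by (auto simp: Z_def intro!: exI[of _ "r / 4"])
    qed
    then show ?thesis using r(1) by (intro exI[of _ "r / 4"]) auto
  qed
  have ZS: "Z \<subseteq> S" by (auto simp: Z_def)
  have nbhd: "\<exists>e>0. ball x e \<inter> S \<subseteq> (if x \<in> Z then Z else S - Z)" if "x \<in> S" for x
  proof -
    obtain e where e: "0 < e" "\<And>w. w \<in> S \<Longrightarrow> norm (w - x) < e \<Longrightarrow> w \<in> Z \<longleftrightarrow> x \<in> Z"
      using local_dichotomy[OF \<open>x \<in> S\<close>] by blast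
    have "ball x e \<inter> S \<subseteq> (if x \<in> Z then Z else S - Z)"
      using e(2) by (auto simp: dist_norm norm_minus_commute)
    then show ?thesis using e(1) by blast
  qed
  have openZ: "openin (top_of_set S) Z"
    unfolding openin_contains_ball
  proof (intro conjI ballI ZS)
    show "\<exists>e>0. ball x e \<inter> S \<subseteq> Z" if "x \<in> Z" for x
      using nbhd[of x] that ZS by auto
  qed
  have openSZ: "openin (top_of_set S) (S - Z)"
    unfolding openin_contains_ball
  proof (intro conjI ballI Diff_subset)
    show "\<exists>e>0. ball x e \<inter> S \<subseteq> S - Z" if "x \<in> S - Z" for x
      using nbhd[of x] that by auto
  qed
  have "Z = {} \<or> Z = S"
    using S(2) openZ openSZ ZS unfolding connected_clopen by (simp add: closedin_def)
  moreover have "y \<in> Z" using y \<epsilon> by (auto simp: Z_def)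
  ultimately have "x \<in> Z" using x by auto
  then show ?thesis using x sub by (auto simp: Z_def)
qed

text \<open>Because \<open>h\<close> and its derivatives vanish on \<open>{s = 0}\<close>, the function \<open>k\<close> that equals \<open>h\<close> where
  \<open>s > 0\<close> and \<open>0\<close> elsewhere is \<open>C\<^sup>1\<close> and satisfies the equation.  It vanishes near \<open>z\<close>, hence on the ball of radius
  \<open>r / 2\<close> around \<open>z\<close>; that ball contains \<open>y\<close>, near which \<open>k = h\<close>.\<close>

lemma vanishing_across_hypersurface:
  assumes S: "openin (top_of_set (span B)) S" and h: "monogenic_on S h dh"
    and a: "a \<in> span B" and r: "0 < r" "\<And>x. x \<in> span B \<Longrightarrow> norm (x - a) < r \<Longrightarrow> x \<in> S"
    and s: "continuous_on {x\<in>span B. norm (x - a) < r} (s :: 'a \<Rightarrow> real)"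
    and zero: "\<And>x. x \<in> span B \<Longrightarrow> norm (x - a) < r \<Longrightarrow> s x = 0 \<Longrightarrow> h x = 0"
    and dzero: "\<And>x b. x \<in> span B \<Longrightarrow> norm (x - a) < r \<Longrightarrow> s x = 0 \<Longrightarrow> b \<in> B \<Longrightarrow> dh b x = 0"
    and z: "z \<in> span B" "norm (z - a) < r / 4" "s z < 0"
    and y: "y \<in> span B" "norm (y - a) < r / 4" "0 < s y"
  shows "\<exists>\<epsilon>>0. \<forall>x\<in>span B. norm (x - y) < \<epsilon> \<longrightarrow> h x = 0"
proof -
  define C where "C = {x. norm (proj x - z) < r / 2}"
  have openC: "open C"
    unfolding C_def by (intro open_Collect_less continuous_intros continuous_proj)
  have C: "proj x \<in> span B" "norm (proj x - a) < r" "proj x \<in> S" if "x \<in> C" for x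
  proof -
    show "norm (proj x - a) < r"
      using that z(2) r(1) norm_triangle_ineq[of "proj x - z" "z - a"] by (simp add: C_def)
    then show "proj x \<in> S" by (rule r(2)[OF proj_in_span])
  qed (rule proj_in_span)
  define \<sigma> where "\<sigma> x = s (proj x)" for x
  have \<sigma>: "continuous_on C \<sigma>"
    unfolding \<sigma>_def[abs_def] using C by (intro continuous_on_compose2[OF s continuous_proj]) auto
  define k where "k x = (if \<sigma> x \<le> 0 then 0 else h (proj x))" for x
  define dk where "dk b x = (if \<sigma> x \<le> 0 then 0 else dh b (proj x))" for b x
  have hC: "C1_along B C (\<lambda>x. h (proj x)) (\<lambda>b x. dh b (proj x))"
    using C by (intro C1_along_subset[OF C1_along_cylinder[OF S h]]) auto
  have k: "C1_along B C k dk"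
  proof (rule C1_alongI)
    show "continuous_on C k"
      unfolding k_def[abs_def]
      by (rule continuous_on_cases_le[OF _ _ \<sigma>])
        (auto intro: continuous_on_subset[OF C1_alongD(1)[OF hC]] simp: \<sigma>_def zero C)
    show "continuous_on C (dk b)" if "b \<in> B" for b
      unfolding dk_def[abs_def]
      by (rule continuous_on_cases_le[OF _ _ \<sigma>])
        (auto intro: continuous_on_subset[OF C1_alongD(2)[OF hC that]] simp: \<sigma>_def dzero C that)
    fix b x assume b: "b \<in> B" and x: "x \<in> C"
    have open_side: "open {x\<in>C. 0 < \<sigma> x}" "open {x\<in>C. \<sigma> x < 0}"
    proof -
      have "{x\<in>C. 0 < \<sigma> x} = C \<inter> \<sigma> -` {0<..}" "{x\<in>C. \<sigma> x < 0} = C \<inter> \<sigma> -` {..<0}" by auto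
      then show "open {x\<in>C. 0 < \<sigma> x}" "open {x\<in>C. \<sigma> x < 0}"
        using continuous_open_preimage[OF \<sigma> openC] by simp_all
    qed
    consider "0 < \<sigma> x" | "\<sigma> x < 0" | "\<sigma> x = 0" by linarith
    then show "((\<lambda>t. k (x + t *\<^sub>R b)) has_vector_derivative dk b x) (at 0)"
    proof cases
      case 1
      have "C1_along B {x\<in>C. 0 < \<sigma> x} k dk"
        by (rule C1_along_cong[OF C1_along_subset[OF hC] open_side(1)]) (auto simp: k_def dk_def)
      then show ?thesis using C1_alongD(3)[OF _ b] 1 x by blast
    next
      case 2
      have "C1_along B {x\<in>C. \<sigma> x < 0} k dk"
        by (rule C1_along_cong[OF C1_along_const[of _ _ 0] open_side(2)]) (auto simp: k_def dk_def)
      then show ?thesis using C1_alongD(3)[OF _ b] 2 x by blast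
    next
      case 3
      have h0: "h (proj x) = 0" "dh b (proj x) = 0"
        using zero dzero C[OF x] b 3 by (auto simp: \<sigma>_def)
      have le: "norm (k y) \<le> norm (h (proj y))" for y by (simp add: k_def)
      have "((\<lambda>t. h (proj (x + t *\<^sub>R b))) has_derivative (\<lambda>t. 0)) (at 0)"
        using C1_alongD(3)[OF hC b x] h0 by (simp add: has_vector_derivative_def)
      then have small: "\<forall>e>0. \<exists>d>0. \<forall>t. \<bar>t\<bar> < d \<longrightarrow> norm (h (proj (x + t *\<^sub>R b))) \<le> e * \<bar>t\<bar>"
        by (simp add: has_derivative_at_alt h0)
      have "\<exists>d>0. \<forall>t. \<bar>t\<bar> < d \<longrightarrow> norm (k (x + t *\<^sub>R b)) \<le> e * \<bar>t\<bar>" if "0 < e" for e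
      proof -
        obtain d where "0 < d" "\<forall>t. \<bar>t\<bar> < d \<longrightarrow> norm (h (proj (x + t *\<^sub>R b))) \<le> e * \<bar>t\<bar>"
          using small \<open>0 < e\<close> by blast
        then show ?thesis using le order_trans by blast
      qed
      then have "((\<lambda>t. k (x + t *\<^sub>R b)) has_vector_derivative 0) (at 0)"
        unfolding has_vector_derivative_def has_derivative_at_alt
        using 3 by (simp add: k_def[of x])
      then show ?thesis by (simp add: dk_def 3)
    qed
  qed
  have vanish: "k x = 0" if "x \<in> C" for x
  proof -
    have "z \<in> {x\<in>span B. norm (x - a) < r}" using z r by auto
    from s[unfolded continuous_on_iff, rule_format, OF this, of "- s z"] z(3)
    obtain d where d': "0 < d"
      "\<forall>x\<in>{x\<in>span B. norm (x - a) < r}. dist x z < d \<longrightarrow> dist (s x) (s z) < - s z" by auto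
    have d: "s x < 0" if "x \<in> span B" "norm (x - a) < r" "norm (x - z) < d" for x
      using d' that by (auto simp: dist_norm dest!: bspec[of _ _ x])
    show ?thesis
    proof (rule unique_continuation[OF z(1), of "r / 2" k dk "min d (r / 2)"])
      show "C1_along B {x. norm (proj x - z) < r / 2} k dk"
        using k by (simp add: C_def)
      show "D dk x = 0" if "norm (proj x - z) < r / 2" for x
        using monogenic_onD(3)[OF h C(3)[of x]] that
        by (cases "\<sigma> x \<le> 0") (simp_all add: D_def dk_def C_def L.zero_right)
      show "k x = 0" if "norm (proj x - z) < min d (r / 2)" for x
        using d[OF proj_in_span[of x] C(2)] that by (auto simp: k_def \<sigma>_def C_def)
    qed (use d'(1) r(1) that in \<open>auto simp: C_def\<close>)
  qed
  have "y \<in> {x\<in>span B. norm (x - a) < r}" using y r by auto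
  from s[unfolded continuous_on_iff, rule_format, OF this, of "s y"] y(3)
  obtain d where d': "0 < d"
    "\<forall>x\<in>{x\<in>span B. norm (x - a) < r}. dist x y < d \<longrightarrow> dist (s x) (s y) < s y" by auto
  have d: "0 < s x" if "x \<in> span B" "norm (x - a) < r" "norm (x - y) < d" for x
    using d'(2) that by (auto simp: dist_norm dest!: bspec[of _ _ x])
  define e where "e = min d (r / 2 - norm (y - z))"
  have yz: "norm (y - z) < r / 2"
    using y(2) z(2) norm_triangle_ineq[of "y - a" "a - z"] by (simp add: norm_minus_commute[of a z])
  have "h x = 0" if x: "x \<in> span B" "norm (x - y) < e" for x
  proof -
    have "norm (x - z) < r / 2"
      using x(2) norm_triangle_ineq[of "x - y" "y - z"] by (simp add: e_def)
    then have xC: "x \<in> C" using x by (simp add: C_def proj_span)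
    have "0 < s x"
      using d[OF x(1)] C(2)[OF xC] x by (simp add: proj_span e_def)
    then show ?thesis
      using vanish[OF xC] x by (simp add: k_def \<sigma>_def proj_span)
  qed
  moreover have "0 < e" using d'(1) yz by (simp add: e_def)
  ultimately show ?thesis by blast
qed

section \<open>Functions vanishing on a submanifold\<close>

lemma dim_span_B: "dim (span B) = card B"
proof -
  have "pairwise orthogonal B"
    using orthonormal by (auto simp: pairwise_def orthogonal_def)
  moreover have "0 \<notin> B" using orthonormal[of 0 0] by auto
  ultimately have "independent B" by (rule pairwise_orthogonal_independent)
  then show ?thesis by (simp add: dim_span dim_eq_card_independent)
qed

text \<open>Let \<open>\<nu>\<close> be the unit normal of \<open>T\<close>.  As the derivative vanishes on \<open>T\<close>, the partial derivatives are
  \<open>(\<nu> \<bullet> b) \<partial>\<^sub>\<nu> h\<close>, and the equation becomes \<open>L \<nu> (\<partial>\<^sub>\<nu> h) = 0\<close>.  But \<open>L \<nu>\<close> preserves the norm.\<close>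

lemma gradient_zero_if_tangential_zero:
  assumes h: "monogenic_on S h dh" and x: "x \<in> S"
    and T: "subspace T" "T \<subseteq> span B" "dim T + 1 = card B"
    and tang: "\<And>v. v \<in> T \<Longrightarrow> (\<Sum>b\<in>B. (v \<bullet> b) *\<^sub>R dh b x) = 0" and b: "b \<in> B"
  shows "dh b x = 0"
proof -
  define lin where "lin v = (\<Sum>b\<in>B. (v \<bullet> b) *\<^sub>R dh b x)" for v
  obtain \<nu> where \<nu>: "\<nu> \<in> span B" "norm \<nu> = 1" "\<And>w. w \<in> span B \<Longrightarrow> w - (w \<bullet> \<nu>) *\<^sub>R \<nu> \<in> T"
    using hyperplane_normal[OF T(1) subspace_span T(2)] T(3) dim_span_B by metis
  have lin_B: "lin c = dh c x" if "c \<in> B" for c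
  proof -
    have "lin c = (\<Sum>b\<in>B. if c = b then dh b x else 0)"
      unfolding lin_def by (rule sum.cong) (simp_all add: orthonormal[OF that])
    then show ?thesis using that finite_B by simp
  qed
  have normal: "dh c x = (\<nu> \<bullet> c) *\<^sub>R lin \<nu>" if "c \<in> B" for c
  proof -
    have "lin (c - (c \<bullet> \<nu>) *\<^sub>R \<nu>) = 0"
      using tang[OF \<nu>(3)[OF span_base[OF that]]] by (simp add: lin_def)
    moreover have "lin (c - (c \<bullet> \<nu>) *\<^sub>R \<nu>) = lin c - (c \<bullet> \<nu>) *\<^sub>R lin \<nu>"
      by (simp add: lin_def inner_diff_left scaleR_diff_left sum_subtractf scaleR_sum_right)
    ultimately show ?thesis using lin_B[OF that] by (simp add: inner_commute)
  qed
  have "0 = D dh x" using monogenic_onD(3)[OF h x] by simp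
  also have "\<dots> = L (\<Sum>c\<in>B. (\<nu> \<bullet> c) *\<^sub>R c) (lin \<nu>)"
    by (simp add: D_def normal L.sum_left L.scaleR_left L.scaleR_right)
  also have "\<dots> = L \<nu> (lin \<nu>)"
    using proj_span[OF \<nu>(1)] by (simp add: proj_def)
  finally have "norm \<nu> * norm (lin \<nu>) = 0"
    by (simp add: norm_L[symmetric])
  then show ?thesis using normal[OF b] \<nu>(2) by simp
qed

lemma bounded_linear_proj: "bounded_linear proj"
  unfolding proj_def[abs_def] by (intro bounded_linear_intros)

text \<open>The curves \<open>t \<mapsto> \<psi> (l + t v)\<close> with \<open>v \<in> K\<close> run inside \<open>M\<close>: their velocity therefore lies in the slice
  space, and \<open>h\<close> is constant along them.\<close>

lemma tangent_space_chart:
  assumes S: "openin (top_of_set (span B)) S" and h: "monogenic_on S h dh"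
    and M: "M \<subseteq> S" "\<And>x. x \<in> M \<Longrightarrow> h x = 0"
    and V: "open V" "l \<in> V" and \<psi>: "(\<psi> has_derivative E) (at l)"
    and K: "subspace K" "l \<in> K" "\<psi> ` (K \<inter> V) \<subseteq> M" and v: "v \<in> K"
  shows "E v \<in> span B" "(\<Sum>b\<in>B. (E v \<bullet> b) *\<^sub>R dh b (\<psi> l)) = 0"
proof -
  have near: "\<forall>\<^sub>F t in nhds (0::real). \<psi> (l + t *\<^sub>R v) \<in> M"
  proof -
    have "l + t *\<^sub>R v \<in> K" for t
      using K(1,2) v by (intro subspace_add subspace_scale)
    then show ?thesis
      using eventually_line_in_open[OF V, of v] K(3) by (auto elim!: eventually_mono)
  qed
  then obtain T where T: "open T" "0 \<in> T" "\<And>t. t \<in> T \<Longrightarrow> \<psi> (l + t *\<^sub>R v) \<in> M"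
    unfolding eventually_nhds by blast
  have MB: "M \<subseteq> span B" using M(1) S openin_imp_subset by blast
  have "((\<lambda>t::real. l + t *\<^sub>R v) has_derivative (\<lambda>t. t *\<^sub>R v)) (at 0)"
    by (auto intro!: derivative_eq_intros)
  moreover have "(\<psi> has_derivative E) (at (l + 0 *\<^sub>R v))" using \<psi> by simp
  ultimately have c: "((\<lambda>t. \<psi> (l + t *\<^sub>R v)) has_derivative (\<lambda>t. E (t *\<^sub>R v))) (at 0)"
    by (rule has_derivative_compose)
  have "((\<lambda>t. proj (\<psi> (l + t *\<^sub>R v))) has_derivative (\<lambda>t. proj (E (t *\<^sub>R v)))) (at 0)"
    by (rule bounded_linear.has_derivative[OF bounded_linear_proj c])
  from has_derivative_transform_within_open[OF this T(1,2), of "\<lambda>t. \<psi> (l + t *\<^sub>R v)"]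
  have "((\<lambda>t. \<psi> (l + t *\<^sub>R v)) has_derivative (\<lambda>t. proj (E (t *\<^sub>R v)))) (at 0)"
    using T(3) MB proj_span by blast
  from has_derivative_unique[OF c this] have "E (1 *\<^sub>R v) = proj (E (1 *\<^sub>R v))" by metis
  then show "E v \<in> span B"
    using proj_in_span[of "E v"] by simp
  have lM: "\<psi> l \<in> M" using T by force
  then have pl: "proj (\<psi> l) = \<psi> l" using MB proj_span by blast
  have "((\<lambda>t. h (proj (\<psi> (l + t *\<^sub>R v)))) has_derivative (\<lambda>t. \<Sum>b\<in>B. (E (t *\<^sub>R v) \<bullet> b) *\<^sub>R dh b (\<psi> l))) (at 0)"
  proof -
    have "((\<lambda>y. h (proj y)) has_derivative (\<lambda>v. \<Sum>b\<in>B. (v \<bullet> b) *\<^sub>R dh b (\<psi> l))) (at (\<psi> (l + 0 *\<^sub>R v)))"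
      using frechet_derivative_on_slice[OF S h, of "\<psi> l"] pl lM M(1) by auto
    from has_derivative_compose[OF c this] show ?thesis .
  qed
  moreover have "((\<lambda>t. h (proj (\<psi> (l + t *\<^sub>R v)))) has_derivative (\<lambda>t. 0)) (at 0)"
    by (rule has_derivative_transform_within_open[OF has_derivative_const[of 0] T(1,2)])
      (use T(3) MB proj_span M(2) in \<open>metis subsetD\<close>)
  ultimately have "(\<lambda>t. \<Sum>b\<in>B. (E (t *\<^sub>R v) \<bullet> b) *\<^sub>R dh b (\<psi> l)) = (\<lambda>t::real. 0)"
    by (rule has_derivative_unique)
  from fun_cong[OF this, of 1] show "(\<Sum>b\<in>B. (E v \<bullet> b) *\<^sub>R dh b (\<psi> l)) = 0" by simp
qed

text \<open>At a point \<open>a\<close> of \<open>M\<close> the derivative of the flattening \<open>\<phi>\<close> maps the slice space onto \<open>K\<close> plus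
  the line of a unit vector \<open>\<eta>\<close> orthogonal to \<open>K\<close>, by counting dimensions, and \<open>s x = \<phi> x \<bullet> \<eta>\<close> serves as the
  function whose signs tell the two sides of \<open>M\<close> apart.

  Near \<open>a\<close> the zero set of \<open>s\<close> in the slice space is contained in \<open>M\<close>: if \<open>s x = 0\<close>, let \<open>l\<close> be the orthogonal projection of \<open>\<phi> x\<close> to \<open>K\<close> and \<open>w = x - \<psi> l\<close>, a vector of
  the slice space.  The difference \<open>k = \<phi> x - l\<close> is orthogonal to \<open>K\<close> and to \<open>\<eta>\<close>, hence to the
  derivative of \<open>\<phi>\<close> applied to \<open>w\<close>; but strict differentiability makes \<open>k\<close> almost equal to that vector, which
  is not small compared with \<open>w\<close> unless \<open>w = 0\<close>.\<close>

lemma vanishing_near_submanifold: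
  assumes S: "openin (top_of_set (span B)) S" and h: "monogenic_on S h dh"
    and M: "smooth_submanifold d M" "d + 1 = card B" "M \<subseteq> S" "\<And>x. x \<in> M \<Longrightarrow> h x = 0"
  shows "\<exists>y\<in>S. \<exists>\<epsilon>>0. \<forall>x\<in>span B. norm (x - y) < \<epsilon> \<longrightarrow> h x = 0"
proof -
  obtain a where a: "a \<in> M" using M(1) by (auto simp: smooth_submanifold_def)
  from M(1)[unfolded smooth_submanifold_def, THEN conjunct2, rule_format, OF a]
  obtain U V K and \<phi> \<psi> :: "'a \<Rightarrow> 'a" where chart: "open U" "a \<in> U" "open V" "homeomorphism U V \<phi> \<psi>"
    "smooth_on \<phi> U" "smooth_on \<psi> V" "subspace K" "dim K = d" "\<phi> ` (M \<inter> U) = K \<inter> V"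
    by blast
  have MB: "M \<subseteq> span B" using M(3) S openin_imp_subset by blast
  have \<psi>\<phi>: "\<psi> (\<phi> x) = x" if "x \<in> U" for x using chart(4) that by (auto simp: homeomorphism_def)
  have \<phi>\<psi>: "\<phi> (\<psi> y) = y" if "y \<in> V" for y using chart(4) that by (auto simp: homeomorphism_def)
  have \<phi>V: "\<phi> x \<in> V" if "x \<in> U" for x using chart(4) that by (auto simp: homeomorphism_def)
  have \<psi>U: "\<psi> y \<in> U" if "y \<in> V" for y using chart(4) that by (auto simp: homeomorphism_def)
  have \<psi>K: "\<psi> ` (K \<inter> V) \<subseteq> M"
  proof -
    have "\<psi> ` (K \<inter> V) = \<psi> ` \<phi> ` (M \<inter> U)" using chart(9) by simp
    also have "\<dots> = M \<inter> U" using \<psi>\<phi> by (force simp: image_image)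
    finally show ?thesis by simp
  qed
  define A where "A x = frechet_derivative \<phi> (at x)" for x
  define E where "E y = frechet_derivative \<psi> (at y)" for y
  have A: "(\<phi> has_derivative A x) (at x)" if "x \<in> U" for x
    using smooth_onD(1)[OF chart(5) that] by (simp add: A_def frechet_derivative_works)
  have E: "(\<psi> has_derivative E y) (at y)" if "y \<in> V" for y
    using smooth_onD(1)[OF chart(6) that] by (simp add: E_def frechet_derivative_works)
  have EA: "E (\<phi> x) (A x v) = v" if "x \<in> U" for x v
    by (rule inverse_derivative[OF chart(1) that \<psi>\<phi> A[OF that] E[OF \<phi>V[OF that]]])
  have AE: "A (\<psi> y) (E y v) = v" if "y \<in> V" for y v
    by (rule inverse_derivative[OF chart(3) that \<phi>\<psi> E[OF that] A[OF \<psi>U[OF that]]])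
  have linA: "linear (A x)" if "x \<in> U" for x using A[OF that] has_derivative_linear by blast
  have linE: "linear (E y)" if "y \<in> V" for y using E[OF that] has_derivative_linear by blast
  have tangent: "E (\<phi> x) v \<in> span B" "(\<Sum>b\<in>B. (E (\<phi> x) v \<bullet> b) *\<^sub>R dh b x) = 0"
    if "x \<in> M" "x \<in> U" "v \<in> K" for x v
  proof -
    have "\<phi> x \<in> K" using chart(9) that by auto
    from tangent_space_chart[OF S h M(3,4) chart(3) \<phi>V[OF that(2)] E[OF \<phi>V[OF that(2)]] chart(7) this \<psi>K that(3)]
    show "E (\<phi> x) v \<in> span B" "(\<Sum>b\<in>B. (E (\<phi> x) v \<bullet> b) *\<^sub>R dh b x) = 0"
      using \<psi>\<phi>[OF that(2)] by auto
  qed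
  have gradient: "dh b x = 0" if x: "x \<in> M" "x \<in> U" and b: "b \<in> B" for x b
  proof (rule gradient_zero_if_tangential_zero[OF h _ _ _ _ _ b])
    show "x \<in> S" using x M(3) by blast
    show "subspace (E (\<phi> x) ` K)"
      by (rule linear_subspace_image[OF linE[OF \<phi>V[OF x(2)]] chart(7)])
    show "E (\<phi> x) ` K \<subseteq> span B" using tangent(1)[OF x] by blast
    have "inj (E (\<phi> x))"
      using AE[OF \<phi>V[OF x(2)]] by (metis injI)
    then have "dim (E (\<phi> x) ` K) = dim K"
      by (intro dim_image_eq[OF linE[OF \<phi>V[OF x(2)]]]) (auto intro: inj_on_subset)
    then show "dim (E (\<phi> x) ` K) + 1 = card B" using chart(8) M(2) by simp
    show "(\<Sum>b\<in>B. (v \<bullet> b) *\<^sub>R dh b x) = 0" if "v \<in> E (\<phi> x) ` K" for v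
      using that tangent(2)[OF x] by blast
  qed
  have aB: "a \<in> span B" and aS: "a \<in> S" using a MB M(3) by auto
  have \<phi>a: "\<phi> a \<in> K" "\<phi> a \<in> V" using a chart(2,9) by auto
  have injA: "inj (A a)" using EA[OF chart(2)] by (metis injI)
  obtain \<eta> where \<eta>: "\<eta> \<in> A a ` span B" "norm \<eta> = 1" "\<And>l. l \<in> K \<Longrightarrow> l \<bullet> \<eta> = 0"
    "\<And>w. w \<in> A a ` span B \<Longrightarrow> w - (w \<bullet> \<eta>) *\<^sub>R \<eta> \<in> K"
  proof (rule hyperplane_normal[OF chart(7), of "A a ` span B"])
    show "subspace (A a ` span B)"
      by (rule linear_subspace_image[OF linA[OF chart(2)] subspace_span])
    show "K \<subseteq> A a ` span B"
      using AE[OF \<phi>a(2)] tangent(1)[OF a chart(2)] \<psi>\<phi>[OF chart(2)] by (metis imageI subsetI)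
    have "dim (A a ` span B) = dim (span B)"
      using injA by (intro dim_image_eq[OF linA[OF chart(2)]]) (auto intro: inj_on_subset)
    then show "dim K + 1 = dim (A a ` span B)"
      using chart(8) M(2) dim_span_B by simp
  qed (rule that)
  obtain w0 where w0: "w0 \<in> span B" "A a w0 = \<eta>" using \<eta>(1) by blast
  obtain c where c: "0 < c" "\<And>v. c * norm v \<le> norm (A a v)"
    using linear_inj_bounded_below_pos[OF linA[OF chart(2)] injA] by (metis mult.commute)
  \<comment> \<open>the error enters twice in the proof of \<open>level\<close>, and \<open>c / 4 + c / 4 < c\<close>\<close>
  obtain r1 where r1: "0 < r1" "\<And>x y. norm (x - a) < r1 \<Longrightarrow> norm (y - a) < r1 \<Longrightarrow>
      norm (\<phi> x - \<phi> y - A a (x - y)) \<le> c / 4 * norm (x - y)"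
    using strictly_differentiable[OF chart(1,2) smooth_onD[OF chart(5)], of "c / 4"] c(1) unfolding A_def by auto
  have "isCont \<psi> (\<phi> a)" using E[OF \<phi>a(2)] has_derivative_continuous by blast
  then obtain d1 where d1: "0 < d1" "\<And>y. norm (y - \<phi> a) < d1 \<Longrightarrow> norm (\<psi> y - a) < r1"
    using r1(1) \<psi>\<phi>[OF chart(2)] unfolding continuous_at_eps_delta dist_norm by auto
  obtain d2 where d2: "0 < d2" "\<And>y. norm (y - \<phi> a) < d2 \<Longrightarrow> y \<in> V"
    using chart(3) \<phi>a(2) unfolding open_dist dist_norm by blast
  have "isCont \<phi> a" using A[OF chart(2)] has_derivative_continuous by blast
  then obtain r2 where r2: "0 < r2" "\<And>x. norm (x - a) < r2 \<Longrightarrow> norm (\<phi> x - \<phi> a) < min d1 d2"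
    using d1(1) d2(1) unfolding continuous_at_eps_delta dist_norm by (metis min_less_iff_conj)
  obtain r3 where r3: "0 < r3" "\<And>x. norm (x - a) < r3 \<Longrightarrow> x \<in> U"
    using chart(1,2) unfolding open_dist dist_norm by blast
  obtain r4 where r4: "0 < r4" "\<And>x. x \<in> span B \<Longrightarrow> norm (x - a) < r4 \<Longrightarrow> x \<in> S"
    using slice_ball[OF S aS] by blast
  define r where "r = min (min r1 r2) (min r3 r4)"
  have r: "0 < r" using r1 r2 r3 r4 by (simp add: r_def)
  have level: "x \<in> M" if x: "x \<in> span B" "norm (x - a) < r" "\<phi> x \<bullet> \<eta> = 0" for x
  proof -
    obtain l k where lk: "l \<in> span K" "\<And>w. w \<in> span K \<Longrightarrow> orthogonal k w" "\<phi> x = l + k"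
      using orthogonal_subspace_decomp_exists[of K "\<phi> x"] by blast
    have l: "l \<in> K" using lk(1) chart(7) by (simp add: span_eq_iff[THEN iffD2])
    have ortho: "k \<bullet> w = 0" if "w \<in> K" for w
      using lk(2)[OF span_base[OF that]] by (simp add: orthogonal_def)
    have "norm (l - \<phi> a) \<le> norm (\<phi> x - \<phi> a)"
    proof -
      have "orthogonal (l - \<phi> a) k"
        using ortho[OF subspace_diff[OF chart(7) l \<phi>a(1)]] by (simp add: orthogonal_def inner_commute)
      from norm_add_Pythagorean[OF this] have "(norm (l - \<phi> a))\<^sup>2 \<le> (norm (\<phi> x - \<phi> a))\<^sup>2"
        by (simp add: lk(3) algebra_simps)
      then show ?thesis by (rule power2_le_imp_le) simp
    qed
    also have "\<dots> < min d1 d2" using r2(2) x(2) by (simp add: r_def)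
    finally have lV: "l \<in> V" and \<psi>l: "norm (\<psi> l - a) < r1" using d1 d2 by auto
    have \<psi>M: "\<psi> l \<in> M" using \<psi>K l lV by blast
    define w where "w = x - \<psi> l"
    have wB: "w \<in> span B" using x(1) \<psi>M MB by (auto simp: w_def intro: span_diff)
    have k_eq: "\<phi> x - \<phi> (\<psi> l) = k" using \<phi>\<psi>[OF lV] lk(3) by simp
    have near: "norm (k - A a w) \<le> c / 4 * norm w"
      using r1(2)[of x "\<psi> l"] x(2) \<psi>l k_eq by (simp add: r_def w_def)
    have "k \<bullet> \<eta> = 0"
      using x(3) lk(3) \<eta>(3)[OF l] by (simp add: inner_add_left)
    moreover have "k \<bullet> (A a w - (A a w \<bullet> \<eta>) *\<^sub>R \<eta>) = 0"
      using ortho \<eta>(4) wB by blast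
    ultimately have "k \<bullet> A a w = 0" by (simp add: inner_diff_right)
    then have "norm k * norm k = k \<bullet> (k - A a w)"
      by (simp add: inner_diff_right norm_eq_sqrt_inner)
    also have "\<dots> \<le> norm k * norm (k - A a w)" by (rule norm_cauchy_schwarz)
    finally have "norm k \<le> norm (k - A a w)"
      by (cases "k = 0") auto
    then have "norm (A a w) \<le> c / 2 * norm w"
      using near norm_triangle_ineq4[of k "k - A a w"] by simp
    then have "c / 2 * norm w \<le> 0" using c(2)[of w] by simp
    then have "w = 0" using c(1) by (simp add: mult_le_0_iff)
    then show ?thesis using \<psi>M by (simp add: w_def)
  qed
  define f where "f t = \<phi> (a + t *\<^sub>R w0) \<bullet> \<eta>" for t
  have "(f has_real_derivative 1) (at 0)"
  proof -
    have "((\<lambda>t::real. a + t *\<^sub>R w0) has_derivative (\<lambda>t. t *\<^sub>R w0)) (at 0)"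
      by (auto intro!: derivative_eq_intros)
    moreover have "(\<phi> has_derivative A a) (at (a + 0 *\<^sub>R w0))" using A[OF chart(2)] by simp
    ultimately have "((\<lambda>t. \<phi> (a + t *\<^sub>R w0)) has_derivative (\<lambda>t. A a (t *\<^sub>R w0))) (at 0)"
      by (rule has_derivative_compose)
    then have "(f has_derivative (\<lambda>t. A a (t *\<^sub>R w0) \<bullet> \<eta>)) (at 0)"
      unfolding f_def by (rule has_derivative_inner_left)
    moreover have "A a (t *\<^sub>R w0) \<bullet> \<eta> = t" for t
      using \<eta>(2) by (simp add: linear_scale[OF linA[OF chart(2)]] w0 norm_eq_sqrt_inner)
    moreover have "(*) (1::real) = (\<lambda>t. t)" by auto
    ultimately show ?thesis by (simp add: has_field_derivative_def)
  qed
  moreover have f0: "f 0 = 0" using \<eta>(3)[OF \<phi>a(1)] by (simp add: f_def)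
  ultimately obtain t1 t2 where t: "0 < t1" "\<And>t. 0 < t \<Longrightarrow> t < t1 \<Longrightarrow> 0 < f t"
      "0 < t2" "\<And>t. 0 < t \<Longrightarrow> t < t2 \<Longrightarrow> f (- t) < 0"
    using DERIV_pos_inc_right[of f 1 0] DERIV_pos_inc_left[of f 1 0] by auto
  define k where "k = norm w0 + 1"
  have k: "0 < k" by (simp add: k_def add_nonneg_pos)
  define q where "q = r / 4 / k"
  have q: "0 < q" "q * k = r / 4" using r k by (simp_all add: q_def)
  define t where "t = min (min t1 t2) q / 2"
  have t_pos: "0 < t" "t < t1" "t < t2" "t < q"
    using t(1,3) q(1) by (auto simp: t_def min_def)
  have small: "norm (s *\<^sub>R w0) < r / 4" if "\<bar>s\<bar> = t" for s
  proof -
    have "t * norm w0 \<le> t * k" using t_pos(1) by (simp add: k_def)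
    also have "\<dots> < r / 4"
      using mult_strict_right_mono[OF t_pos(4) k] q(2) by simp
    finally show ?thesis using that by simp
  qed
  have "\<exists>\<epsilon>>0. \<forall>x\<in>span B. norm (x - (a + t *\<^sub>R w0)) < \<epsilon> \<longrightarrow> h x = 0"
  proof (rule vanishing_across_hypersurface[OF S h aB r, where s = "\<lambda>x. \<phi> x \<bullet> \<eta>" and z = "a + (- t) *\<^sub>R w0"])
    show "x \<in> S" if "x \<in> span B" "norm (x - a) < r" for x using r4(2) that by (simp add: r_def)
    have "continuous_on U \<phi>" using chart(4) by (simp add: homeomorphism_def)
    moreover have "{x\<in>span B. norm (x - a) < r} \<subseteq> U" using r3(2) by (auto simp: r_def)
    ultimately show "continuous_on {x\<in>span B. norm (x - a) < r} (\<lambda>x. \<phi> x \<bullet> \<eta>)"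
      by (intro continuous_on_inner continuous_on_const) (rule continuous_on_subset)
    show "h x = 0" if "x \<in> span B" "norm (x - a) < r" "\<phi> x \<bullet> \<eta> = 0" for x
      using M(4) level that by blast
    show "dh b x = 0" if "x \<in> span B" "norm (x - a) < r" "\<phi> x \<bullet> \<eta> = 0" "b \<in> B" for x b
      using gradient level r3(2) that by (simp add: r_def)
    show "a + - t *\<^sub>R w0 \<in> span B" "a + t *\<^sub>R w0 \<in> span B"
      by (intro span_add span_scale aB w0(1))+
    show "norm (a + - t *\<^sub>R w0 - a) < r / 4" "norm (a + t *\<^sub>R w0 - a) < r / 4"
      using small[of "- t"] small[of t] t_pos(1) by auto
    show "\<phi> (a + - t *\<^sub>R w0) \<bullet> \<eta> < 0" using t(4)[OF t_pos(1,3)] by (simp add: f_def)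
    show "0 < \<phi> (a + t *\<^sub>R w0) \<bullet> \<eta>" using t(2)[OF t_pos(1,2)] by (simp add: f_def)
  qed
  moreover have "a + t *\<^sub>R w0 \<in> S"
  proof (rule r4(2))
    show "a + t *\<^sub>R w0 \<in> span B" by (intro span_add span_scale aB w0(1))
    show "norm (a + t *\<^sub>R w0 - a) < r4"
      using small[of t] t_pos(1) r by (simp add: r_def)
  qed
  ultimately show ?thesis by blast
qed

end

section \<open>Octonions and their slices\<close>

lemma UNIV_8: "(UNIV :: 8 set) = {0, 1, 2, 3, 4, 5, 6, 7}"
proof -
  have "card {0, 1, 2, 3, 4, 5, 6, 7 :: 8} = card (UNIV :: 8 set)" by simp
  then show ?thesis by (metis card_subset_eq finite subset_UNIV)
qed

lemma UNIV_8_of_nat: "(UNIV :: 8 set) = of_nat ` {..7}"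
proof -
  have "{..7::nat} = {0, 1, 2, 3, 4, 5, 6, 7}" by auto
  then show ?thesis unfolding UNIV_8 by simp
qed

lemma bounded_bilinear_oct_mult: "bounded_bilinear oct_mult"
  unfolding bilinear_conv_bounded_bilinear[symmetric] bilinear_def linear_iff
  by (simp add: oct_mult_def sum.distrib distrib_left distrib_right scaleR_add_left scaleR_sum_right mult_ac)

lemma sum_8: "(\<Sum>i\<le>7::nat. f i) = f 0 + f 1 + f 2 + f 3 + f 4 + f 5 + f 6 + f 7"
  by (simp add: numeral_eq_Suc add.assoc)

lemma sum_1_7: "(\<Sum>i=1..7::nat. f i) = f 1 + f 2 + f 3 + f 4 + f 5 + f 6 + f 7"
  by (simp add: numeral_eq_Suc add.assoc)

lemma oct_e_mult_0: "oct_e_mult 0 j = oct_e j" "oct_e_mult i 0 = oct_e i"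
  by (simp_all add: oct_e_mult_def)

lemma oct_e_mult_table:
  shows
    "oct_e_mult 1 1 = - oct_e 0" "oct_e_mult 1 2 = oct_e 3" "oct_e_mult 1 3 = - oct_e 2" "oct_e_mult 1 4 = oct_e 5" "oct_e_mult 1 5 = - oct_e 4" "oct_e_mult 1 6 = - oct_e 7" "oct_e_mult 1 7 = oct_e 6"
    "oct_e_mult 2 1 = - oct_e 3" "oct_e_mult 2 2 = - oct_e 0" "oct_e_mult 2 3 = oct_e 1" "oct_e_mult 2 4 = oct_e 6" "oct_e_mult 2 5 = oct_e 7" "oct_e_mult 2 6 = - oct_e 4" "oct_e_mult 2 7 = - oct_e 5"
    "oct_e_mult 3 1 = oct_e 2" "oct_e_mult 3 2 = - oct_e 1" "oct_e_mult 3 3 = - oct_e 0" "oct_e_mult 3 4 = oct_e 7" "oct_e_mult 3 5 = - oct_e 6" "oct_e_mult 3 6 = oct_e 5" "oct_e_mult 3 7 = - oct_e 4"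
    "oct_e_mult 4 1 = - oct_e 5" "oct_e_mult 4 2 = - oct_e 6" "oct_e_mult 4 3 = - oct_e 7" "oct_e_mult 4 4 = - oct_e 0" "oct_e_mult 4 5 = oct_e 1" "oct_e_mult 4 6 = oct_e 2" "oct_e_mult 4 7 = oct_e 3"
    "oct_e_mult 5 1 = oct_e 4" "oct_e_mult 5 2 = - oct_e 7" "oct_e_mult 5 3 = oct_e 6" "oct_e_mult 5 4 = - oct_e 1" "oct_e_mult 5 5 = - oct_e 0" "oct_e_mult 5 6 = - oct_e 3" "oct_e_mult 5 7 = oct_e 2"
    "oct_e_mult 6 1 = oct_e 7" "oct_e_mult 6 2 = oct_e 4" "oct_e_mult 6 3 = - oct_e 5" "oct_e_mult 6 4 = - oct_e 2" "oct_e_mult 6 5 = oct_e 3" "oct_e_mult 6 6 = - oct_e 0" "oct_e_mult 6 7 = - oct_e 1"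
    "oct_e_mult 7 1 = - oct_e 6" "oct_e_mult 7 2 = oct_e 5" "oct_e_mult 7 3 = oct_e 4" "oct_e_mult 7 4 = - oct_e 3" "oct_e_mult 7 5 = - oct_e 2" "oct_e_mult 7 6 = oct_e 1" "oct_e_mult 7 7 = - oct_e 0"
  unfolding oct_e_mult_def sum_1_7 oct_eps_def oct_triples_def by simp_all

lemma oct_mult_components:
  fixes x y :: octonion
  shows
    "(x \<odot> y) $ 0 = x$0*y$0 - x$1*y$1 - x$2*y$2 - x$3*y$3 - x$4*y$4 - x$5*y$5 - x$6*y$6 - x$7*y$7"
    "(x \<odot> y) $ 1 = x$0*y$1 + x$1*y$0 + x$2*y$3 - x$3*y$2 + x$4*y$5 - x$5*y$4 + x$7*y$6 - x$6*y$7"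
    "(x \<odot> y) $ 2 = x$0*y$2 + x$2*y$0 + x$3*y$1 - x$1*y$3 + x$4*y$6 - x$6*y$4 + x$5*y$7 - x$7*y$5"
    "(x \<odot> y) $ 3 = x$0*y$3 + x$3*y$0 + x$1*y$2 - x$2*y$1 + x$4*y$7 - x$7*y$4 + x$6*y$5 - x$5*y$6"
    "(x \<odot> y) $ 4 = x$0*y$4 + x$4*y$0 + x$5*y$1 - x$1*y$5 + x$6*y$2 - x$2*y$6 + x$7*y$3 - x$3*y$7"
    "(x \<odot> y) $ 5 = x$0*y$5 + x$5*y$0 + x$1*y$4 - x$4*y$1 + x$3*y$6 - x$6*y$3 + x$7*y$2 - x$2*y$7"
    "(x \<odot> y) $ 6 = x$0*y$6 + x$6*y$0 + x$2*y$4 - x$4*y$2 + x$5*y$3 - x$3*y$5 + x$1*y$7 - x$7*y$1"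
    "(x \<odot> y) $ 7 = x$0*y$7 + x$7*y$0 + x$3*y$4 - x$4*y$3 + x$6*y$1 - x$1*y$6 + x$2*y$5 - x$5*y$2"
  unfolding oct_mult_def sum_8 oct_e_mult_0 oct_e_mult_table oct_e_def
  by (simp_all add: axis_def)

text \<open>The eight-square identity of Degen, checked as a polynomial identity in the 16 coordinates.\<close>

lemma norm_oct_mult: "norm (x \<odot> y) = norm x * norm y"
proof -
  have sq: "(norm z)\<^sup>2 = (z$0)\<^sup>2 + (z$1)\<^sup>2 + (z$2)\<^sup>2 + (z$3)\<^sup>2 + (z$4)\<^sup>2 + (z$5)\<^sup>2 + (z$6)\<^sup>2 + (z$7)\<^sup>2"
    for z :: octonion
    unfolding power2_norm_eq_inner inner_vec_def UNIV_8 by (simp add: power2_eq_square)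
  have "(norm (x \<odot> y))\<^sup>2 = (norm x * norm y)\<^sup>2"
    unfolding power_mult_distrib sq oct_mult_components by algebra
  then show ?thesis by (rule power2_eq_imp_eq) simp_all
qed

lemma inner_oct_e: "i \<le> 7 \<Longrightarrow> j \<le> 7 \<Longrightarrow> oct_e i \<bullet> oct_e j = (if i = j then 1 else 0)"
  by (simp add: oct_e_def inner_axis_axis of_nat_8_eq_iff)

lemma oct_e_inj: "inj_on oct_e {..7}"
  by (auto simp: inj_on_def oct_e_def axis_eq_axis of_nat_8_eq_iff)

lemma octonion_expansion: "x = (\<Sum>i\<le>7. x $ of_nat i *\<^sub>R oct_e i)"
proof -
  have inj: "inj_on (of_nat :: nat \<Rightarrow> 8) {..7}"
    by (auto simp: inj_on_def of_nat_8_eq_iff)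
  have "x = (\<Sum>k\<in>UNIV. x $ k *\<^sub>R axis k 1)"
    using basis_expansion[of x] by (simp add: scalar_mult_eq_scaleR)
  also have "\<dots> = (\<Sum>i\<le>7. x $ of_nat i *\<^sub>R oct_e i)"
    unfolding UNIV_8_of_nat using inj by (simp add: sum.reindex oct_e_def)
  finally show ?thesis .
qed

lemma paravectors_eq_span:
  assumes "p \<le> 6"
  shows "paravectors p = span (oct_e ` {0..p})"
proof
  show "paravectors p \<subseteq> span (oct_e ` {0..p})"
    by (auto simp: paravectors_def intro!: span_sum span_scale intro: span_base)
  have inj: "inj_on oct_e {0..p}"
    using oct_e_inj by (rule inj_on_subset) (use assms in auto)
  show "span (oct_e ` {0..p}) \<subseteq> paravectors p"
  proof
    fix x assume "x \<in> span (oct_e ` {0..p})"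
    then obtain u where "x = (\<Sum>v\<in>oct_e ` {0..p}. u v *\<^sub>R v)"
      by (auto simp: span_finite)
    then have "x = (\<Sum>i=0..p. u (oct_e i) *\<^sub>R oct_e i)"
      using inj by (simp add: sum.reindex)
    then show "x \<in> paravectors p" unfolding paravectors_def by auto
  qed
qed

definition slice_basis :: "nat \<Rightarrow> octonion \<Rightarrow> octonion set" where
  "slice_basis p \<omega> = insert \<omega> (oct_e ` {0..p})"

lemma slice_space_eq_span:
  assumes "p \<le> 6"
  shows "slice_space p \<omega> = span (slice_basis p \<omega>)"
proof (rule set_eqI)
  fix x
  have "x \<in> slice_space p \<omega> \<longleftrightarrow> (\<exists>k. x - k *\<^sub>R \<omega> \<in> paravectors p)"
  proof
    assume "x \<in> slice_space p \<omega>"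
    then obtain v r where "x = v + r *\<^sub>R \<omega>" "v \<in> paravectors p" unfolding slice_space_def by blast
    then show "\<exists>k. x - k *\<^sub>R \<omega> \<in> paravectors p" by (intro exI[of _ r]) simp
  next
    assume "\<exists>k. x - k *\<^sub>R \<omega> \<in> paravectors p"
    then obtain k where "x - k *\<^sub>R \<omega> \<in> paravectors p" by blast
    moreover have "x = (x - k *\<^sub>R \<omega>) + k *\<^sub>R \<omega>" by simp
    ultimately show "x \<in> slice_space p \<omega>" unfolding slice_space_def by blast
  qed
  then show "x \<in> slice_space p \<omega> \<longleftrightarrow> x \<in> span (slice_basis p \<omega>)"
    by (simp add: slice_basis_def span_breakdown_eq paravectors_eq_span[OF assms])
qed

lemma slice_sphere_inner:
  assumes "p \<le> 6" "\<omega> \<in> slice_sphere p"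
  shows "\<omega> \<bullet> \<omega> = 1" "j \<le> p \<Longrightarrow> \<omega> \<bullet> oct_e j = 0"
proof -
  obtain a where \<omega>: "\<omega> = (\<Sum>i=p+1..7. a i *\<^sub>R oct_e i)" and a: "(\<Sum>i=p+1..7. (a i)\<^sup>2) = 1"
    using assms(2) by (auto simp: slice_sphere_def)
  have *: "\<omega> \<bullet> oct_e j = (\<Sum>i=p+1..7. if i = j then a i else 0)" if "j \<le> 7" for j
    unfolding \<omega> inner_sum_left by (rule sum.cong) (use that in \<open>auto simp: inner_oct_e\<close>)
  show "j \<le> p \<Longrightarrow> \<omega> \<bullet> oct_e j = 0"
    using *[of j] assms(1) by simp
  have "\<omega> \<bullet> \<omega> = (\<Sum>i=p+1..7. a i * (\<omega> \<bullet> oct_e i))"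
    by (subst (2) \<omega>) (simp add: inner_sum_right)
  also have "\<dots> = (\<Sum>i=p+1..7. (a i)\<^sup>2)"
    by (rule sum.cong) (auto simp: * power2_eq_square)
  finally show "\<omega> \<bullet> \<omega> = 1" using a by simp
qed

lemma slice_basis_props:
  assumes "p \<le> 6" "\<omega> \<in> slice_sphere p"
  shows "\<omega> \<notin> oct_e ` {0..p}" "card (slice_basis p \<omega>) = p + 2"
proof -
  show "\<omega> \<notin> oct_e ` {0..p}"
    using slice_sphere_inner[OF assms] by fastforce
  moreover have "card (oct_e ` {0..p}) = p + 1"
    using card_image[OF inj_on_subset[OF oct_e_inj], of "{0..p}"] assms(1) by auto
  ultimately show "card (slice_basis p \<omega>) = p + 2"
    by (simp add: slice_basis_def)
qed

lemma dirac_slice: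
  assumes "p \<le> 6" "\<omega> \<in> slice_sphere p"
  shows "dirac (slice_basis p \<omega>) oct_mult"
proof (rule dirac.intro)
  show "finite (slice_basis p \<omega>)" by (simp add: slice_basis_def)
  show "bounded_bilinear oct_mult" by (rule bounded_bilinear_oct_mult)
  show "norm (a \<odot> x) = norm a * norm x" for a x by (rule norm_oct_mult)
  show "b \<bullet> c = (if b = c then 1 else 0)" if "b \<in> slice_basis p \<omega>" "c \<in> slice_basis p \<omega>" for b c
    using that slice_sphere_inner[OF assms] slice_basis_props(1)[OF assms] assms(1) oct_e_inj
    by (auto simp: slice_basis_def inner_oct_e inner_commute[of "oct_e _" \<omega>] inj_on_def)
qed

lemma monogenic_on_slice_diff:
  assumes p: "p \<le> 6" and \<omega>: "\<omega> \<in> slice_sphere p"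
    and f: "partial_slice_monogenic p \<Omega> f" and g: "partial_slice_monogenic p \<Omega> g"
  shows "dirac.monogenic_on (slice_basis p \<omega>) oct_mult (slice p \<Omega> \<omega>) (\<lambda>x. f x - g x)
    (\<lambda>b x. partial f b x - partial g b x)"
proof -
  interpret dirac "slice_basis p \<omega>" oct_mult by (rule dirac_slice[OF p \<omega>])
  interpret L: bounded_bilinear oct_mult by (rule bounded_bilinear_oct_mult)
  have C1: "continuous_on (slice p \<Omega> \<omega>) (partial u b)"
    "x \<in> slice p \<Omega> \<omega> \<Longrightarrow> ((\<lambda>t. u (x + t *\<^sub>R b)) has_vector_derivative partial u b x) (at 0)"
    if "partial_slice_monogenic p \<Omega> u" "b \<in> slice_basis p \<omega>" for u b x
    using that \<omega>
    by (auto simp: partial_slice_monogenic_def C1_on_slice_def slice_basis_def partial_def vector_derivative_works)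
  have D_eq: "D (partial u) x = slice_dirac p \<omega> u x" for u x
  proof -
    have "inj_on oct_e {0..p}"
      using oct_e_inj by (rule inj_on_subset) (use p in auto)
    then show ?thesis
      using slice_basis_props(1)[OF p \<omega>]
      unfolding D_def slice_dirac_def unfolding slice_basis_def by (simp add: sum.reindex add.commute)
  qed
  have "D (\<lambda>b x. partial f b x - partial g b x) x = D (partial f) x - D (partial g) x" for x
    by (simp add: D_def L.diff_right sum_subtractf)
  then have "D (\<lambda>b x. partial f b x - partial g b x) x = 0" if "x \<in> slice p \<Omega> \<omega>" for x
    using f g \<omega> that by (simp add: D_eq partial_slice_monogenic_def)
  then show ?thesis
    using C1[OF f] C1[OF g]
    by (auto simp: monogenic_on_def intro!: continuous_on_diff has_vector_derivative_diff)
qed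

lemma in_some_slice_space:
  assumes p: "p \<le> 6"
  shows "\<exists>\<omega>\<in>slice_sphere p. x \<in> slice_space p \<omega>"
proof -
  define r where "r = sqrt (\<Sum>i=p+1..7. (x $ of_nat i)\<^sup>2)"
  have r2: "r\<^sup>2 = (\<Sum>i=p+1..7. (x $ of_nat i)\<^sup>2)"
    by (simp add: r_def sum_nonneg)
  define v where "v = (\<Sum>i=0..p. x $ of_nat i *\<^sub>R oct_e i)"
  have v: "v \<in> paravectors p" by (auto simp: v_def paravectors_def)
  have "{..7} = {0..p} \<union> {p+1..7}" using p by auto
  then have x: "x = v + (\<Sum>i=p+1..7. x $ of_nat i *\<^sub>R oct_e i)"
    by (subst octonion_expansion) (simp add: v_def sum.union_disjoint)
  show ?thesis
  proof (cases "r = 0")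
    case True
    then have "x $ of_nat i = 0" if "i \<in> {p+1..7}" for i
      using r2 that by (simp add: sum_nonneg_eq_0_iff)
    then have xv: "x = v" using x by simp
    have "oct_e 7 \<in> slice_sphere p"
    proof -
      have "oct_e 7 = (\<Sum>i=p+1..7. (if i = 7 then 1 else 0) *\<^sub>R oct_e i)"
        using p by (simp add: if_distrib[of "\<lambda>c. c *\<^sub>R _"] cong: if_cong)
      moreover have "(\<Sum>i=p+1..7. (if i = 7 then 1 else 0 :: real)\<^sup>2) = 1"
        using p by (simp add: if_distrib[of "\<lambda>c. c\<^sup>2"] cong: if_cong)
      ultimately show ?thesis
        unfolding slice_sphere_def by (intro CollectI exI[of _ "\<lambda>i. if i = 7 then 1 else 0"] conjI)
    qed
    moreover have "x \<in> slice_space p (oct_e 7)"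
      unfolding slice_space_def using v xv by (intro CollectI exI[of _ v] exI[of _ 0]) simp
    ultimately show ?thesis by blast
  next
    case False
    define \<omega> where "\<omega> = (\<Sum>i=p+1..7. (x $ of_nat i / r) *\<^sub>R oct_e i)"
    have "(\<Sum>i=p+1..7. (x $ of_nat i / r)\<^sup>2) = r\<^sup>2 / r\<^sup>2"
      unfolding r2 by (simp only: power_divide r2 sum_divide_distrib)
    then have "(\<Sum>i=p+1..7. (x $ of_nat i / r)\<^sup>2) = 1"
      using False by simp
    then have "\<omega> \<in> slice_sphere p"
      unfolding slice_sphere_def \<omega>_def by (intro CollectI exI[of _ "\<lambda>i. x $ of_nat i / r"] conjI refl)
    moreover have "x = v + r *\<^sub>R \<omega>"
      using x False by (simp add: \<omega>_def scaleR_sum_right)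
    ultimately show ?thesis
      unfolding slice_space_def using v by blast
  qed
qed

text \<open>Within the slice of \<open>\<omega>\<close> the paravectors are the hyperplane \<open>{x \<bullet> \<omega> = 0}\<close>.  The derivatives of
  \<open>f - g\<close> along \<open>e\<^sub>0, \<dots>, e\<^sub>p\<close> vanish on it, so \<open>vanishing_across_hypersurface\<close> applies with
  \<open>s x = x \<bullet> \<omega>\<close>.\<close>

lemma vanishing_on_paravectors_spreads:
  assumes p: "p \<le> 6" and \<Omega>: "slice_domain p \<Omega>"
    and f: "partial_slice_monogenic p \<Omega> f" and g: "partial_slice_monogenic p \<Omega> g"
    and eq: "\<And>x. x \<in> \<Omega> \<Longrightarrow> x \<in> paravectors p \<Longrightarrow> f x = g x"
    and \<omega>: "\<omega> \<in> slice_sphere p" and x: "x \<in> slice p \<Omega> \<omega>"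
  shows "f x = g x"
proof -
  interpret dirac "slice_basis p \<omega>" oct_mult by (rule dirac_slice[OF p \<omega>])
  let ?W = "span (slice_basis p \<omega>)"
  define h where "h x = f x - g x" for x
  define dh where "dh b x = partial f b x - partial g b x" for b x
  have h: "monogenic_on (slice p \<Omega> \<omega>) h dh"
    unfolding h_def[abs_def] dh_def[abs_def] by (rule monogenic_on_slice_diff[OF p \<omega> f g])
  have S: "openin (top_of_set ?W) (slice p \<Omega> \<omega>)" "connected (slice p \<Omega> \<omega>)"
    using \<Omega> \<omega> slice_space_eq_span[OF p] by (auto simp: slice_domain_def)
  have PW: "paravectors p \<subseteq> ?W"
    unfolding paravectors_eq_span[OF p] slice_basis_def by (intro span_mono) auto
  have subP: "subspace (paravectors p)" by (simp add: paravectors_eq_span[OF p])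
  have inner_P: "v \<bullet> \<omega> = 0" if "v \<in> paravectors p" for v
    using that slice_sphere_inner(2)[OF p \<omega>]
    by (auto simp: paravectors_def inner_sum_left inner_commute[of "oct_e _" \<omega>])
  have in_P: "v \<in> paravectors p" if "v \<in> ?W" "v \<bullet> \<omega> = 0" for v
  proof -
    have "v \<in> slice_space p \<omega>" using that(1) by (simp add: slice_space_eq_span[OF p])
    then obtain u c where u: "v = u + c *\<^sub>R \<omega>" "u \<in> paravectors p"
      unfolding slice_space_def by blast
    then show ?thesis
      using that(2) inner_P[OF u(2)] slice_sphere_inner(1)[OF p \<omega>] by (simp add: inner_add_left)
  qed
  have dim: "dim (paravectors p) + 1 = card (slice_basis p \<omega>)"
  proof -
    have "pairwise orthogonal (oct_e ` {0..p})" "0 \<notin> oct_e ` {0..p}"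
      using orthonormal orthonormal[of 0 0] by (auto simp: pairwise_def orthogonal_def slice_basis_def)
    then have "independent (oct_e ` {0..p})" by (rule pairwise_orthogonal_independent)
    moreover have "card (oct_e ` {0..p}) + 1 = card (slice_basis p \<omega>)"
      using slice_basis_props(1)[OF p \<omega>] by (simp add: slice_basis_def)
    ultimately show ?thesis
      by (simp add: paravectors_eq_span[OF p] dim_eq_card_independent)
  qed
  have zero: "h y = 0" if "y \<in> \<Omega>" "y \<in> paravectors p" for y
    using eq that by (simp add: h_def)
  have gradient: "dh b y = 0" if y: "y \<in> slice p \<Omega> \<omega>" "y \<in> paravectors p" and b: "b \<in> slice_basis p \<omega>" for y b
  proof (rule gradient_zero_if_tangential_zero[OF h y(1) subP PW dim _ b])
    fix v assume v: "v \<in> paravectors p"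
    have "(v \<bullet> c) *\<^sub>R dh c y = 0" if c: "c \<in> slice_basis p \<omega>" for c
    proof (cases "c = \<omega>")
      case False
      then have cP: "c \<in> paravectors p"
        using c unfolding paravectors_eq_span[OF p] slice_basis_def by (auto intro: span_base)
      have "open \<Omega>" "y \<in> \<Omega>" using \<Omega> y(1) by (auto simp: slice_domain_def slice_def)
      from eventually_line_in_open[OF this, of c]
      obtain T where T: "open T" "0 \<in> T" "\<And>t::real. t \<in> T \<Longrightarrow> y + t *\<^sub>R c \<in> \<Omega>"
        unfolding eventually_nhds by blast
      have "((\<lambda>t. h (y + t *\<^sub>R c)) has_vector_derivative 0) (at 0)"
        unfolding has_vector_derivative_def
        by (rule has_derivative_transform_within_open[OF _ T(1,2), of "\<lambda>t. 0"])
          (auto simp: zero T(3) subP y(2) cP subspace_add subspace_scale)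
      then have "dh c y = 0"
        using monogenic_onD(2)[OF h c y(1)] vector_derivative_unique_at by blast
      then show ?thesis by simp
    qed (simp add: inner_P[OF v])
    then show "(\<Sum>c\<in>slice_basis p \<omega>. (v \<bullet> c) *\<^sub>R dh c y) = 0" by (intro sum.neutral ballI)
  qed
  obtain a where a: "a \<in> \<Omega>" "a \<in> paravectors p"
    using \<Omega> by (auto simp: slice_domain_def)
  have aW: "a \<in> ?W" using a PW by blast
  have aS: "a \<in> slice p \<Omega> \<omega>" using a aW by (simp add: slice_def slice_space_eq_span[OF p])
  obtain r where r: "0 < r" "\<And>x. x \<in> ?W \<Longrightarrow> norm (x - a) < r \<Longrightarrow> x \<in> slice p \<Omega> \<omega>"
    using slice_ball[OF S(1) aS] by blast
  have \<omega>W: "\<omega> \<in> ?W" by (rule span_base) (simp add: slice_basis_def)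
  have norm_\<omega>: "norm \<omega> = 1" using slice_sphere_inner(1)[OF p \<omega>] by (simp add: norm_eq_sqrt_inner)
  \<comment> \<open>any point of the slice off the hyperplane, within \<open>r / 4\<close> of \<open>a\<close>\<close>
  define y where "y = a + (r / 8) *\<^sub>R \<omega>"
  have yW: "y \<in> ?W" unfolding y_def by (intro span_add span_scale aW \<omega>W)
  have "\<exists>\<epsilon>>0. \<forall>x\<in>?W. norm (x - y) < \<epsilon> \<longrightarrow> h x = 0"
  proof (rule vanishing_across_hypersurface[OF S(1) h aW r, where s = "\<lambda>x. x \<bullet> \<omega>" and z = "a + (- (r / 8)) *\<^sub>R \<omega>"])
    show "continuous_on {x \<in> ?W. norm (x - a) < r} (\<lambda>x. x \<bullet> \<omega>)"
      by (intro continuous_intros)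
    show "h x = 0" if "x \<in> ?W" "norm (x - a) < r" "x \<bullet> \<omega> = 0" for x
      using zero in_P that r(2) by (auto simp: slice_def)
    show "dh b x = 0" if "x \<in> ?W" "norm (x - a) < r" "x \<bullet> \<omega> = 0" "b \<in> slice_basis p \<omega>" for x b
      using gradient in_P that r(2) by blast
    show "a + (- (r / 8)) *\<^sub>R \<omega> \<in> ?W" by (intro span_add span_scale aW \<omega>W)
  qed (use yW r(1) norm_\<omega> inner_P[OF a(2)] slice_sphere_inner(1)[OF p \<omega>] in \<open>auto simp: y_def inner_add_left inner_diff_left\<close>)
  then obtain \<epsilon> where \<epsilon>: "0 < \<epsilon>" "\<And>x. x \<in> ?W \<Longrightarrow> norm (x - y) < \<epsilon> \<Longrightarrow> h x = 0" by blast
  have "y \<in> slice p \<Omega> \<omega>" using r(2)[OF yW] r(1) norm_\<omega> by (simp add: y_def)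
  from identity_theorem_slice[OF S h this \<epsilon> x] show ?thesis by (simp add: h_def)
qed

theorem theorem3p14:
  fixes p :: nat and \<Omega> :: "octonion set" and f g :: "octonion \<Rightarrow> octonion"
  assumes "p \<le> 6"
    and "slice_domain p \<Omega>"
    and "partial_slice_monogenic p \<Omega> f"
    and "partial_slice_monogenic p \<Omega> g"
    and "\<exists>\<omega>\<in>slice_sphere p. \<exists>M. smooth_submanifold (p + 1) M \<and> M \<subseteq> slice p \<Omega> \<omega> \<and>
           (\<forall>x\<in>M. f x = g x)"
  shows "\<forall>x\<in>\<Omega>. f x = g x"
proof
  fix x assume x: "x \<in> \<Omega>"
  note p = assms(1)
  obtain \<omega> M where \<omega>: "\<omega> \<in> slice_sphere p" and M: "smooth_submanifold (p + 1) M" "M \<subseteq> slice p \<Omega> \<omega>"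
    "\<And>x. x \<in> M \<Longrightarrow> f x = g x"
    using assms(5) by blast
  have on_slice: "f y = g y" if y: "y \<in> slice p \<Omega> \<omega>" for y
  proof -
    interpret dirac "slice_basis p \<omega>" oct_mult by (rule dirac_slice[OF p \<omega>])
    note h = monogenic_on_slice_diff[OF p \<omega> assms(3,4)]
    have S: "openin (top_of_set (span (slice_basis p \<omega>))) (slice p \<Omega> \<omega>)" "connected (slice p \<Omega> \<omega>)"
      using assms(2) \<omega> slice_space_eq_span[OF p] by (auto simp: slice_domain_def)
    have "p + 1 + 1 = card (slice_basis p \<omega>)" using slice_basis_props(2)[OF p \<omega>] by simp
    from vanishing_near_submanifold[OF S(1) h M(1) this M(2)] M(3)
    obtain z \<epsilon> where z: "z \<in> slice p \<Omega> \<omega>" "0 < \<epsilon>"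
      "\<And>w. w \<in> span (slice_basis p \<omega>) \<Longrightarrow> norm (w - z) < \<epsilon> \<Longrightarrow> f w - g w = 0" by auto
    from identity_theorem_slice[OF S h z y] show ?thesis by simp
  qed
  have "f y = g y" if "y \<in> \<Omega>" "y \<in> paravectors p" for y
  proof (rule on_slice)
    have "y + 0 *\<^sub>R \<omega> \<in> slice_space p \<omega>" unfolding slice_space_def using that(2) by blast
    then show "y \<in> slice p \<Omega> \<omega>" using that(1) by (simp add: slice_def)
  qed
  moreover obtain \<omega>' where "\<omega>' \<in> slice_sphere p" "x \<in> slice p \<Omega> \<omega>'"
    using in_some_slice_space[OF p, of x] x by (auto simp: slice_def)
  ultimately show "f x = g x"
    using vanishing_on_paravectors_spreads[OF p assms(2-4)] by blast
qed

end
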